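(* Let $c_0\in\mathcal{M}=G/H$ and let $\alpha\colon C^\infty(I,T\mathcal{M})\cong TC^\infty(I,\mathcal{M})\to C^\infty(I,\mathfrak{g})$ be a smooth map such that $\rho_{c_0}\circ\alpha\circ D=\mathrm{id}_{C^\infty_{c_0}(I,\mathcal{M})}$ and $\alpha\circ D(\mathcal{P}_{c_0})\subseteq C^\infty(I,\mathfrak{g}\setminus\{0\})$. Let $\mathcal{R}(c)=\alpha(\dot c)/\sqrt{\|\alpha(\dot c)\|}$ be the square root velocity transform on $\mathcal{P}_{c_0}$ with respect to $c_0$ and $\alpha$, and let $$d_{\mathcal{P}_{c_0}}(f,g):=\sqrt{\int_0^1\|\mathcal{R}(f)(t)-\mathcal{R}(g)(t)\|^2\,dt},\qquad f,g\in\mathcal{P}_{c_0}.$$ Then $d_{\mathcal{P}_{c_0}}$ is reparametrisation invariant if $\alpha$ is a $C^\infty(I,\mathfrak{g})$-valued $1$-form on $C^\infty(I,\mathcal{M})$, e.g. if $\alpha=\theta_\omega\colon f\mapsto\omega\circ f$ for a $\mathfrak{g}$-valued $1$-form $\omega$ on $\mathcal{M}$.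
   Context: $G$ is a finite-dimensional Lie group with identity $e$ and Lie algebra $\mathfrak{g}=T_eG$; $H\subseteq G$ is a closed Lie subgroup; $\mathcal{M}=G/H$ carries the manifold structure making $\pi\colon G\to G/H$, $g\mapsto gH$, a submersion. $\Lambda\colon G\times\mathcal{M}\to\mathcal{M}$, $(g,kH)\mapsto (gk)H$, and $\Lambda_{c_0}(g)=\Lambda(g,c_0)$. $I=[0,1]$. For a manifold $N$, $C^\infty(I,N)$ carries the compact-open $C^\infty$-topology and its usual infinite-dimensional (Fréchet) manifold structure; smoothness is in the sense of Bastiani calculus. $\mathrm{Imm}(I,\mathcal{M})\subseteq C^\infty(I,\mathcal{M})$ is the open subset of curves with nowhere vanishing derivative. $\mathrm{Evol}\colon C^\infty(I,\mathfrak{g})\to\{g\in C^\infty(I,G): g(0)=e\}$ sends $q$ to the solution $g$ of $\dot g(t)=T_eR_{g(t)}(q(t))$, $g(0)=e$, where $R_g$ is right multiplication by $g$. $C^\infty_{c_0}(I,\mathcal{M})=\{c\in C^\infty(I,\mathcal{M}): c(0)=c_0\}$, $\mathcal{P}_{c_0}=\mathrm{Imm}(I,\mathcal{M})\cap C^\infty_{c_0}(I,\mathcal{M})$, $\rho_{c_0}(q)(t)=\Lambda_{c_0}(\mathrm{Evol}(q)(t))$ for $q\in C^\infty(I,\mathfrak{g})$, and $D(c)=\dot c$. $\|\cdot\|$ is the norm on $\mathfrak{g}$ of a fixed inner product coming from a right invariant Riemannian metric on $G$. $\mathrm{Diff}^+(I)$ is the group of orientation preserving diffeomorphisms of $I$,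 acting on $\mathcal{P}_{c_0}$ from the right by composition. A metric (distance function) $d\colon\mathcal{P}_{c_0}\times\mathcal{P}_{c_0}\to[0,\infty[$ is called reparametrisation invariant if $d(f,g)=d(f\circ\varphi,g\circ\varphi)$ for all $f,g\in\mathcal{P}_{c_0}$ and all $\varphi\in\mathrm{Diff}^+(I)$. A $1$-form is in particular fibre-wise linear.
   Formalization: For general 1-forms the claim fails with mere real fibre-wise linearity (non-local α); it is proved assuming α is fibre-wise linear over smooth functions on I and commutes with reparametrisation, α(v∘φ)=α(v)∘φ. The case α=θ_ω is proved as stated. *)

theory Defs
  imports "HOL-Analysis.Analysis" "HOL-Algebra.Left_Coset"
begin

section \<open>Bastiani calculus\<close>

text \<open>
  \<open>d k x v\<close> is the iterated directional derivative of \<open>f\<close> at \<open>x\<close> in the directions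
  \<open>v 0, \<dots>, v (k - 1)\<close>; the remaining entries of \<open>v\<close> are irrelevant. The map is smooth if all of
  these exist and are jointly continuous. The limits are taken within \<open>S\<close>, so that the same
  definition covers open sets as well as \<open>[0,1]\<close> and \<open>[0,1] \<times> W\<close> with \<open>W\<close> open (and relatively
  open subsets of these), where every direction or its opposite is admissible at every point.
\<close>

definition smooth_on ::
    "'a::{real_vector,topological_space} set \<Rightarrow> ('a \<Rightarrow> 'b::{real_vector,topological_space}) \<Rightarrow> bool"
  where "smooth_on S f \<longleftrightarrow>
    (\<exists>d :: nat \<Rightarrow> 'a \<Rightarrow> (nat \<Rightarrow> 'a) \<Rightarrow> 'b.
      (\<forall>x\<in>S. \<forall>v. d 0 x v = f x) \<and>
      (\<forall>k. \<forall>x\<in>S. \<forall>v.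
        ((\<lambda>h::real. (1 / h) *\<^sub>R (d k (x + h *\<^sub>R v k) v - d k x v)) \<longlongrightarrow> d (Suc k) x v)
          (at 0 within {h. x + h *\<^sub>R v k \<in> S})) \<and>
      (\<forall>k. continuous_on (S \<times> UNIV) (\<lambda>(x, v). d k x v)))"

lemma smooth_on_const:
  fixes c :: "'b::real_normed_vector"
  shows "smooth_on S (\<lambda>_. c)"
  unfolding smooth_on_def
  by (rule exI[of _ "\<lambda>k x v. if k = 0 then c else 0"]) (auto simp: case_prod_unfold)

lemma smooth_on_add:
  fixes f g :: "'a::{real_vector,topological_space} \<Rightarrow> 'b::real_normed_vector"
  assumes "smooth_on S f" "smooth_on S g"
  shows "smooth_on S (\<lambda>x. f x + g x)"
proof -
  obtain d where d0: "\<And>x v. x \<in> S \<Longrightarrow> d 0 x v = f x"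
    and d1: "\<And>k x v. x \<in> S \<Longrightarrow>
      ((\<lambda>h::real. (1 / h) *\<^sub>R (d k (x + h *\<^sub>R v k) v - d k x v)) \<longlongrightarrow> d (Suc k) x v)
          (at 0 within {h. x + h *\<^sub>R v k \<in> S})"
    and d2: "\<And>k. continuous_on (S \<times> UNIV) (\<lambda>(x, v). d k x v)"
    using assms(1) unfolding smooth_on_def by blast
  obtain d' where e0: "\<And>x v. x \<in> S \<Longrightarrow> d' 0 x v = g x"
    and e1: "\<And>k x v. x \<in> S \<Longrightarrow>
      ((\<lambda>h::real. (1 / h) *\<^sub>R (d' k (x + h *\<^sub>R v k) v - d' k x v)) \<longlongrightarrow> d' (Suc k) x v)
          (at 0 within {h. x + h *\<^sub>R v k \<in> S})"
    and e2: "\<And>k. continuous_on (S \<times> UNIV) (\<lambda>(x, v). d' k x v)"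
    using assms(2) unfolding smooth_on_def by blast
  have 1: "((\<lambda>h::real. (1 / h) *\<^sub>R ((d k (x + h *\<^sub>R v k) v + d' k (x + h *\<^sub>R v k) v)
      - (d k x v + d' k x v))) \<longlongrightarrow> d (Suc k) x v + d' (Suc k) x v)
          (at 0 within {h. x + h *\<^sub>R v k \<in> S})" if "x \<in> S" for k x v
    using tendsto_add[OF d1[OF that, where k = k and v = v] e1[OF that, where k = k and v = v]]
    by (simp add: algebra_simps)
  have 2: "continuous_on (S \<times> UNIV) (\<lambda>(x, v). d k x v + d' k x v)" for k
    using continuous_on_add[OF d2[of k] e2[of k]] by (simp add: case_prod_unfold)
  show ?thesis unfolding smooth_on_def
    by (rule exI[of _ "\<lambda>k x v. d k x v + d' k x v"]) (auto simp: d0 e0 1 2)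
qed

lemma smooth_on_scaleR:
  fixes f :: "'a::{real_vector,topological_space} \<Rightarrow> 'b::real_normed_vector"
  assumes "smooth_on S f"
  shows "smooth_on S (\<lambda>x. r *\<^sub>R f x)"
proof -
  obtain d where d0: "\<And>x v. x \<in> S \<Longrightarrow> d 0 x v = f x"
    and d1: "\<And>k x v. x \<in> S \<Longrightarrow>
      ((\<lambda>h::real. (1 / h) *\<^sub>R (d k (x + h *\<^sub>R v k) v - d k x v)) \<longlongrightarrow> d (Suc k) x v)
          (at 0 within {h. x + h *\<^sub>R v k \<in> S})"
    and d2: "\<And>k. continuous_on (S \<times> UNIV) (\<lambda>(x, v). d k x v)"
    using assms(1) unfolding smooth_on_def by blast
  have 1: "((\<lambda>h::real. (1 / h) *\<^sub>R (r *\<^sub>R d k (x + h *\<^sub>R v k) v - r *\<^sub>R d k x v))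
      \<longlongrightarrow> r *\<^sub>R d (Suc k) x v) (at 0 within {h. x + h *\<^sub>R v k \<in> S})" if "x \<in> S" for k x v
    using tendsto_scaleR[OF tendsto_const[of r] d1[OF that, where k = k and v = v]]
    by (simp add: algebra_simps)
  have 2: "continuous_on (S \<times> UNIV) (\<lambda>(x, v). r *\<^sub>R d k x v)" for k
    using continuous_on_scaleR[OF continuous_on_const[of _ r] d2[of k]] by (simp add: case_prod_unfold)
  show ?thesis unfolding smooth_on_def
    by (rule exI[of _ "\<lambda>k x v. r *\<^sub>R d k x v"]) (auto simp: d0 1 2)
qed

section \<open>The space of smooth curves in a normed space\<close>

text \<open>Curves on \<open>[0,1]\<close> are normalised to be \<open>0\<close> outside \<open>[0,1]\<close>.\<close>

typedef (overloaded) ('e::real_normed_vector) smooth_curve =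
    "{f :: real \<Rightarrow> 'e. smooth_on {0..1} f \<and> (\<forall>t. t \<notin> {0..1} \<longrightarrow> f t = 0)}"
  morphisms curve_fun Abs_smooth_curve
  by (rule exI[of _ "\<lambda>_. 0"]) (simp add: smooth_on_const)

setup_lifting type_definition_smooth_curve

instantiation smooth_curve :: (real_normed_vector) real_vector
begin

lift_definition zero_smooth_curve :: "'a smooth_curve" is "\<lambda>_. 0"
  by (simp add: smooth_on_const)

lift_definition plus_smooth_curve :: "'a smooth_curve \<Rightarrow> 'a smooth_curve \<Rightarrow> 'a smooth_curve"
  is "\<lambda>f g t. f t + g t"
  by (simp add: smooth_on_add)

lift_definition scaleR_smooth_curve :: "real \<Rightarrow> 'a smooth_curve \<Rightarrow> 'a smooth_curve"
  is "\<lambda>r f t. r *\<^sub>R f t"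
  by (simp add: smooth_on_scaleR)

lift_definition uminus_smooth_curve :: "'a smooth_curve \<Rightarrow> 'a smooth_curve"
  is "\<lambda>f t. - f t"
  subgoal for f using smooth_on_scaleR[of "{0..1}" f "-1"] by simp
  done

lift_definition minus_smooth_curve :: "'a smooth_curve \<Rightarrow> 'a smooth_curve \<Rightarrow> 'a smooth_curve"
  is "\<lambda>f g t. f t - g t"
  subgoal for f g
    using smooth_on_add[of "{0..1}" f "\<lambda>t. (-1) *\<^sub>R g t"] smooth_on_scaleR[of "{0..1}" g "-1"] by simp
  done

instance
  by standard (transfer; simp add: algebra_simps fun_eq_iff)+

end

primrec curve_deriv :: "nat \<Rightarrow> (real \<Rightarrow> 'e::real_normed_vector) \<Rightarrow> real \<Rightarrow> 'e" where
  "curve_deriv 0 f = f"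
| "curve_deriv (Suc k) f = (\<lambda>t. vector_derivative (curve_deriv k f) (at t within {0..1}))"

text \<open>
  The compact-open \<open>C\<^sup>\<infinity>\<close>-topology: on the compact interval it is the topology of uniform convergence
  of all derivatives.
\<close>

instantiation smooth_curve :: (real_normed_vector) topological_space
begin

definition open_smooth_curve :: "'a smooth_curve set \<Rightarrow> bool" where
  "open_smooth_curve U \<longleftrightarrow>
    (\<forall>f\<in>U. \<exists>k. \<exists>\<epsilon>>0. \<forall>g.
      (\<forall>j\<le>k. \<forall>t\<in>{0..1}.
        dist (curve_deriv j (curve_fun g) t) (curve_deriv j (curve_fun f) t) < \<epsilon>) \<longrightarrow> g \<in> U)"

instance
proof
  show "open (UNIV :: 'a smooth_curve set)"
    unfolding open_smooth_curve_def by (auto intro: exI[of _ 1])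
next
  fix S T :: "'a smooth_curve set"
  assume S: "open S" and T: "open T"
  show "open (S \<inter> T)"
    unfolding open_smooth_curve_def
  proof
    fix f assume f: "f \<in> S \<inter> T"
    obtain k1 e1 where 1: "e1 > 0" "\<And>g. (\<forall>j\<le>k1. \<forall>t\<in>{0..1}.
        dist (curve_deriv j (curve_fun g) t) (curve_deriv j (curve_fun f) t) < e1) \<Longrightarrow> g \<in> S"
      using S f unfolding open_smooth_curve_def by (metis IntD1)
    obtain k2 e2 where 2: "e2 > 0" "\<And>g. (\<forall>j\<le>k2. \<forall>t\<in>{0..1}.
        dist (curve_deriv j (curve_fun g) t) (curve_deriv j (curve_fun f) t) < e2) \<Longrightarrow> g \<in> T"
      using T f unfolding open_smooth_curve_def by (metis IntD2)
    show "\<exists>k. \<exists>\<epsilon>>0. \<forall>g. (\<forall>j\<le>k. \<forall>t\<in>{0..1}.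
        dist (curve_deriv j (curve_fun g) t) (curve_deriv j (curve_fun f) t) < \<epsilon>) \<longrightarrow> g \<in> S \<inter> T"
      using 1 2 by (intro exI[of _ "max k1 k2"] exI[of _ "min e1 e2"]) auto
  qed
next
  fix K :: "'a smooth_curve set set"
  assume K: "\<forall>S\<in>K. open S"
  show "open (\<Union>K)"
    unfolding open_smooth_curve_def
  proof
    fix f assume "f \<in> \<Union>K"
    then obtain S where S: "S \<in> K" "f \<in> S" by blast
    with K obtain k e where "e > 0" "\<And>g. (\<forall>j\<le>k. \<forall>t\<in>{0..1}.
        dist (curve_deriv j (curve_fun g) t) (curve_deriv j (curve_fun f) t) < e) \<Longrightarrow> g \<in> S"
      unfolding open_smooth_curve_def by metis
    with S show "\<exists>k. \<exists>\<epsilon>>0. \<forall>g. (\<forall>j\<le>k. \<forall>t\<in>{0..1}.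
        dist (curve_deriv j (curve_fun g) t) (curve_deriv j (curve_fun f) t) < \<epsilon>) \<longrightarrow> g \<in> \<Union>K"
      by blast
  qed
qed

end

section \<open>Finite-dimensional manifolds\<close>

text \<open>
  A manifold is represented by an atlas, its underlying set being the union of the chart domains.
  The model space is a type of sort \<open>{real_normed_vector,heine_borel}\<close>: by Riesz's theorem these are
  exactly the finite-dimensional normed spaces (unlike \<open>euclidean_space\<close>, dimension \<open>0\<close> is included).
\<close>

type_synonym ('a, 'e) chart = "'a set \<times> ('a \<Rightarrow> 'e)"

definition chart_inv :: "('a, 'e) chart \<Rightarrow> 'e \<Rightarrow> 'a" where
  "chart_inv \<kappa> = the_inv_into (fst \<kappa>) (snd \<kappa>)"

definition manifold_set :: "('a, 'e) chart set \<Rightarrow> 'a set" where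
  "manifold_set A = (\<Union>\<kappa>\<in>A. fst \<kappa>)"

definition mopen :: "('a, 'e::real_normed_vector) chart set \<Rightarrow> 'a set \<Rightarrow> bool" where
  "mopen A W \<longleftrightarrow> W \<subseteq> manifold_set A \<and> (\<forall>\<kappa>\<in>A. open (snd \<kappa> ` (W \<inter> fst \<kappa>)))"

definition mclosed :: "('a, 'e::real_normed_vector) chart set \<Rightarrow> 'a set \<Rightarrow> bool" where
  "mclosed A C \<longleftrightarrow> C \<subseteq> manifold_set A \<and> mopen A (manifold_set A - C)"

definition manifold :: "('a, 'e::{real_normed_vector,heine_borel}) chart set \<Rightarrow> bool" where
  "manifold A \<longleftrightarrow>
    (\<forall>\<kappa>\<in>A. inj_on (snd \<kappa>) (fst \<kappa>) \<and> open (snd \<kappa> ` fst \<kappa>)) \<and>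
    (\<forall>\<kappa>\<in>A. \<forall>\<mu>\<in>A. open (snd \<kappa> ` (fst \<kappa> \<inter> fst \<mu>)) \<and>
      smooth_on (snd \<kappa> ` (fst \<kappa> \<inter> fst \<mu>)) (snd \<mu> \<circ> chart_inv \<kappa>)) \<and>
    (\<forall>p\<in>manifold_set A. \<forall>q\<in>manifold_set A. p \<noteq> q \<longrightarrow>
      (\<exists>V W. mopen A V \<and> mopen A W \<and> p \<in> V \<and> q \<in> W \<and> V \<inter> W = {}))"

definition smooth_map ::
    "('a, 'e::real_normed_vector) chart set \<Rightarrow> ('b, 'f::real_normed_vector) chart set \<Rightarrow> ('a \<Rightarrow> 'b) \<Rightarrow> bool"
  where "smooth_map A B F \<longleftrightarrow>
    F \<in> manifold_set A \<rightarrow> manifold_set B \<and>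
    (\<forall>\<kappa>\<in>A. \<forall>\<mu>\<in>B.
      open (snd \<kappa> ` (fst \<kappa> \<inter> F -` fst \<mu>)) \<and>
      smooth_on (snd \<kappa> ` (fst \<kappa> \<inter> F -` fst \<mu>)) (snd \<mu> \<circ> F \<circ> chart_inv \<kappa>))"

definition prod_atlas ::
    "('a, 'e) chart set \<Rightarrow> ('b, 'f) chart set \<Rightarrow> ('a \<times> 'b, 'e \<times> 'f) chart set" where
  "prod_atlas A B = {(fst \<kappa> \<times> fst \<mu>, map_prod (snd \<kappa>) (snd \<mu>)) | \<kappa> \<mu>. \<kappa> \<in> A \<and> \<mu> \<in> B}"

section \<open>Tangent vectors\<close>

text \<open>
  A tangent vector at \<open>p\<close> is the family of its coordinate vectors in all charts around \<open>p\<close> (and \<open>0\<close>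
  in all other charts), related by the derivatives of the coordinate changes. The vector space
  structure is thus pointwise.
\<close>

type_synonym ('a, 'e) tangent = "('a, 'e) chart \<Rightarrow> 'e"

definition chart_at :: "('a, 'e) chart set \<Rightarrow> 'a \<Rightarrow> ('a, 'e) chart \<Rightarrow> bool" where
  "chart_at A p \<kappa> \<longleftrightarrow> \<kappa> \<in> A \<and> p \<in> fst \<kappa>"

definition tangent_space ::
    "('a, 'e::real_normed_vector) chart set \<Rightarrow> 'a \<Rightarrow> ('a, 'e) tangent set" where
  "tangent_space A p = {v.
    (\<forall>\<kappa>. \<not> chart_at A p \<kappa> \<longrightarrow> v \<kappa> = 0) \<and>
    (\<forall>\<kappa> \<mu>. chart_at A p \<kappa> \<longrightarrow> chart_at A p \<mu> \<longrightarrow>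
      v \<mu> = frechet_derivative (snd \<mu> \<circ> chart_inv \<kappa>) (at (snd \<kappa> p)) (v \<kappa>))}"

definition tzero :: "('a, 'e::real_normed_vector) tangent" where
  "tzero = (\<lambda>_. 0)"

definition tadd :: "('a, 'e::real_normed_vector) tangent \<Rightarrow> ('a, 'e) tangent \<Rightarrow> ('a, 'e) tangent" where
  "tadd v w = (\<lambda>\<kappa>. v \<kappa> + w \<kappa>)"

definition tdiff :: "('a, 'e::real_normed_vector) tangent \<Rightarrow> ('a, 'e) tangent \<Rightarrow> ('a, 'e) tangent" where
  "tdiff v w = (\<lambda>\<kappa>. v \<kappa> - w \<kappa>)"

definition tscale :: "real \<Rightarrow> ('a, 'e::real_normed_vector) tangent \<Rightarrow> ('a, 'e) tangent" where
  "tscale r v = (\<lambda>\<kappa>. r *\<^sub>R v \<kappa>)"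

definition tangent_map ::
    "('a, 'e::real_normed_vector) chart set \<Rightarrow> ('b, 'f::real_normed_vector) chart set \<Rightarrow> ('a \<Rightarrow> 'b)
      \<Rightarrow> 'a \<Rightarrow> ('a, 'e) tangent \<Rightarrow> ('b, 'f) tangent" where
  "tangent_map A B F p v = (\<lambda>\<mu>.
    if chart_at B (F p) \<mu>
    then let \<kappa> = (SOME \<kappa>. chart_at A p \<kappa>)
         in frechet_derivative (snd \<mu> \<circ> F \<circ> chart_inv \<kappa>) (at (snd \<kappa> p)) (v \<kappa>)
    else 0)"

definition submersion ::
    "('a, 'e::real_normed_vector) chart set \<Rightarrow> ('b, 'f::real_normed_vector) chart set \<Rightarrow> ('a \<Rightarrow> 'b) \<Rightarrow> bool"
  where "submersion A B F \<longleftrightarrow>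
    smooth_map A B F \<and>
    (\<forall>p\<in>manifold_set A. tangent_map A B F p ` tangent_space A p = tangent_space B (F p))"

definition tangent_bundle ::
    "('a, 'e::real_normed_vector) chart set \<Rightarrow> ('a \<times> ('a, 'e) tangent, 'e \<times> 'e) chart set" where
  "tangent_bundle A =
    {({(p, v). p \<in> fst \<kappa> \<and> v \<in> tangent_space A p}, \<lambda>(p, v). (snd \<kappa> p, v \<kappa>)) | \<kappa>. \<kappa> \<in> A}"

section \<open>Smooth curves in a manifold\<close>

text \<open>Curves in a manifold are extensional functions, i.e. \<open>undefined\<close> outside \<open>[0,1]\<close>.\<close>

definition curves :: "('a, 'e::real_normed_vector) chart set \<Rightarrow> (real \<Rightarrow> 'a) set" where
  "curves A = {c \<in> {0..1} \<rightarrow>\<^sub>E manifold_set A.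
    \<forall>\<kappa>\<in>A. openin (top_of_set {0..1}) {t\<in>{0..1}. c t \<in> fst \<kappa>} \<and>
      smooth_on {t\<in>{0..1}. c t \<in> fst \<kappa>} (snd \<kappa> \<circ> c)}"

definition velocity :: "('a, 'e::real_normed_vector) chart set \<Rightarrow> (real \<Rightarrow> 'a) \<Rightarrow> real \<Rightarrow> ('a, 'e) tangent"
  where "velocity A c t = (\<lambda>\<kappa>.
    if chart_at A (c t) \<kappa> then vector_derivative (snd \<kappa> \<circ> c) (at t within {0..1}) else 0)"

text \<open>\<open>curve_D A c\<close> is the derivative of \<open>c\<close> as a curve in the tangent bundle.\<close>

definition curve_D ::
    "('a, 'e::real_normed_vector) chart set \<Rightarrow> (real \<Rightarrow> 'a) \<Rightarrow> real \<Rightarrow> 'a \<times> ('a, 'e) tangent" where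
  "curve_D A c = (\<lambda>t\<in>{0..1}. (c t, velocity A c t))"

definition immersed_curves :: "('a, 'e::real_normed_vector) chart set \<Rightarrow> (real \<Rightarrow> 'a) set" where
  "immersed_curves A = {c \<in> curves A. \<forall>t\<in>{0..1}. velocity A c t \<noteq> tzero}"

definition curves_from :: "('a, 'e::real_normed_vector) chart set \<Rightarrow> 'a \<Rightarrow> (real \<Rightarrow> 'a) set" where
  "curves_from A p = {c \<in> curves A. c 0 = p}"

definition immersed_curves_from :: "('a, 'e::real_normed_vector) chart set \<Rightarrow> 'a \<Rightarrow> (real \<Rightarrow> 'a) set"
  where "immersed_curves_from A p = immersed_curves A \<inter> curves_from A p"

text \<open>
  The charts of the Frechet manifold of smooth curves in a manifold \<open>N\<close>, given by their inverses
  (Palais' vector bundle neighbourhoods; over an interval every vector bundle is trivial). If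
  \<open>(t, x) \<mapsto> (t, \<Phi> t x)\<close> is a diffeomorphism of \<open>[0,1] \<times> W\<close> onto an open subset of \<open>[0,1] \<times> N\<close>,
  then \<open>\<sigma> \<mapsto> (t \<mapsto> \<Phi> t (\<sigma> t))\<close> parametrises an open set of curves by the open set of those
  \<open>\<sigma>\<close> in the Frechet space of smooth curves in the model space that take values in \<open>W\<close>.
\<close>

definition tube ::
    "('a, 'e::real_normed_vector) chart set \<Rightarrow> 'e set \<Rightarrow> (real \<Rightarrow> 'e \<Rightarrow> 'a) \<Rightarrow> bool" where
  "tube A W \<Phi> \<longleftrightarrow>
    open W \<and>
    (\<forall>t\<in>{0..1}. inj_on (\<Phi> t) W \<and> \<Phi> t ` W \<subseteq> manifold_set A) \<and>
    (\<forall>\<kappa>\<in>A.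
      (let S = {(t, x). t \<in> {0..1} \<and> x \<in> W \<and> \<Phi> t x \<in> fst \<kappa>}
       in openin (top_of_set ({0..1} \<times> UNIV)) S \<and> smooth_on S (\<lambda>(t, x). snd \<kappa> (\<Phi> t x))) \<and>
      (let S = {(t, snd \<kappa> p) | t p. t \<in> {0..1} \<and> p \<in> fst \<kappa> \<inter> \<Phi> t ` W}
       in openin (top_of_set ({0..1} \<times> UNIV)) S \<and>
          smooth_on S (\<lambda>(t, y). the_inv_into W (\<Phi> t) (chart_inv \<kappa> y))))"

section \<open>Lie groups, right invariant metrics and the evolution map\<close>

definition lie_group ::
    "('g, 'z) monoid_scheme \<Rightarrow> ('g, 'e::{real_normed_vector,heine_borel}) chart set \<Rightarrow> bool" where
  "lie_group G A \<longleftrightarrow>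
    group G \<and> manifold A \<and> manifold_set A = carrier G \<and>
    smooth_map (prod_atlas A A) A (\<lambda>(x, y). x \<otimes>\<^bsub>G\<^esub> y) \<and>
    smooth_map A A (\<lambda>x. inv\<^bsub>G\<^esub> x)"

text \<open>
  \<open>\<M> = G/H\<close> is the set of left cosets; the manifold structure for which the projection is a submersion
  is unique. A closed subgroup of a finite-dimensional Lie group is a Lie subgroup (Cartan).
\<close>

definition homogeneous_space ::
    "('g, 'z) monoid_scheme \<Rightarrow> ('g, 'e::{real_normed_vector,heine_borel}) chart set \<Rightarrow> 'g set
      \<Rightarrow> ('g set, 'f::{real_normed_vector,heine_borel}) chart set \<Rightarrow> bool" where
  "homogeneous_space G A H B \<longleftrightarrow>
    lie_group G A \<and> subgroup H G \<and> mclosed A H \<and>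
    manifold B \<and> manifold_set B = lcosets\<^bsub>G\<^esub> H \<and> submersion A B (\<lambda>g. g <#\<^bsub>G\<^esub> H)"

definition inner_product_on ::
    "('a, 'e::real_normed_vector) tangent set
      \<Rightarrow> (('a, 'e) tangent \<Rightarrow> ('a, 'e) tangent \<Rightarrow> real) \<Rightarrow> bool" where
  "inner_product_on V ip \<longleftrightarrow>
    (\<forall>u\<in>V. \<forall>v\<in>V. ip u v = ip v u) \<and>
    (\<forall>u\<in>V. \<forall>v\<in>V. \<forall>w\<in>V. ip (tadd u v) w = ip u w + ip v w) \<and>
    (\<forall>r. \<forall>u\<in>V. \<forall>v\<in>V. ip (tscale r u) v = r * ip u v) \<and>
    (\<forall>u\<in>V. u \<noteq> tzero \<longrightarrow> ip u u > 0)"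

definition tangent_of_coord ::
    "('a, 'e::real_normed_vector) chart set \<Rightarrow> 'a \<Rightarrow> ('a, 'e) chart \<Rightarrow> 'e \<Rightarrow> ('a, 'e) tangent" where
  "tangent_of_coord A p \<kappa> a = (THE v. v \<in> tangent_space A p \<and> v \<kappa> = a)"

definition riemannian_metric ::
    "('a, 'e::real_normed_vector) chart set
      \<Rightarrow> ('a \<Rightarrow> ('a, 'e) tangent \<Rightarrow> ('a, 'e) tangent \<Rightarrow> real) \<Rightarrow> bool" where
  "riemannian_metric A m \<longleftrightarrow>
    (\<forall>p\<in>manifold_set A. inner_product_on (tangent_space A p) (m p)) \<and>
    (\<forall>\<kappa>\<in>A. \<forall>a b. smooth_on (snd \<kappa> ` fst \<kappa>)
      (\<lambda>x. m (chart_inv \<kappa> x)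
             (tangent_of_coord A (chart_inv \<kappa> x) \<kappa> a) (tangent_of_coord A (chart_inv \<kappa> x) \<kappa> b)))"

definition right_invariant ::
    "('g, 'z) monoid_scheme \<Rightarrow> ('g, 'e::real_normed_vector) chart set
      \<Rightarrow> ('g \<Rightarrow> ('g, 'e) tangent \<Rightarrow> ('g, 'e) tangent \<Rightarrow> real) \<Rightarrow> bool" where
  "right_invariant G A m \<longleftrightarrow>
    (\<forall>p\<in>carrier G. \<forall>g\<in>carrier G. \<forall>u\<in>tangent_space A p. \<forall>v\<in>tangent_space A p.
      m (p \<otimes>\<^bsub>G\<^esub> g) (tangent_map A A (\<lambda>x. x \<otimes>\<^bsub>G\<^esub> g) p u) (tangent_map A A (\<lambda>x. x \<otimes>\<^bsub>G\<^esub> g) p v)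
        = m p u v)"

definition lie_algebra ::
    "('g, 'z) monoid_scheme \<Rightarrow> ('g, 'e::real_normed_vector) chart set \<Rightarrow> ('g, 'e) tangent set" where
  "lie_algebra G A = tangent_space A \<one>\<^bsub>G\<^esub>"

definition lie_norm ::
    "('g, 'z) monoid_scheme \<Rightarrow> ('g \<Rightarrow> ('g, 'e) tangent \<Rightarrow> ('g, 'e) tangent \<Rightarrow> real)
      \<Rightarrow> ('g, 'e::real_normed_vector) tangent \<Rightarrow> real" where
  "lie_norm G m v = sqrt (m \<one>\<^bsub>G\<^esub> v v)"

text \<open>The evaluation \<open>v \<mapsto> v \<kappa>\<close> at a chart around the identity is a linear isomorphism from the
  Lie algebra to the model space.\<close>

definition lie_curves ::
    "('g, 'z) monoid_scheme \<Rightarrow> ('g, 'e::real_normed_vector) chart set \<Rightarrow> (real \<Rightarrow> ('g, 'e) tangent) set"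
  where "lie_curves G A = {q \<in> {0..1} \<rightarrow>\<^sub>E lie_algebra G A.
    \<forall>\<kappa>. chart_at A \<one>\<^bsub>G\<^esub> \<kappa> \<longrightarrow> smooth_on {0..1} (\<lambda>t. q t \<kappa>)}"

definition evol ::
    "('g, 'z) monoid_scheme \<Rightarrow> ('g, 'e::real_normed_vector) chart set
      \<Rightarrow> (real \<Rightarrow> ('g, 'e) tangent) \<Rightarrow> real \<Rightarrow> 'g" where
  "evol G A q = (THE g. g \<in> curves A \<and> g 0 = \<one>\<^bsub>G\<^esub> \<and>
    (\<forall>t\<in>{0..1}. velocity A g t = tangent_map A A (\<lambda>x. x \<otimes>\<^bsub>G\<^esub> g t) \<one>\<^bsub>G\<^esub> (q t)))"

definition rho ::
    "('g, 'z) monoid_scheme \<Rightarrow> ('g, 'e::real_normed_vector) chart set \<Rightarrow> 'g set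
      \<Rightarrow> (real \<Rightarrow> ('g, 'e) tangent) \<Rightarrow> real \<Rightarrow> 'g set" where
  "rho G A c\<^sub>0 q = (\<lambda>t\<in>{0..1}. evol G A q t <#\<^bsub>G\<^esub> c\<^sub>0)"

section \<open>Maps from curves in the tangent bundle to curves in the Lie algebra\<close>

definition smooth_curve_map ::
    "('n, 'f::real_normed_vector) chart set \<Rightarrow> ('g, 'z) monoid_scheme
      \<Rightarrow> ('g, 'e::real_normed_vector) chart set
      \<Rightarrow> ((real \<Rightarrow> 'n) \<Rightarrow> (real \<Rightarrow> ('g, 'e) tangent)) \<Rightarrow> bool" where
  "smooth_curve_map N G A \<alpha> \<longleftrightarrow>
    \<alpha> \<in> curves N \<rightarrow> lie_curves G A \<and>
    (\<forall>W \<Phi> \<kappa>. tube N W \<Phi> \<longrightarrow> chart_at A \<one>\<^bsub>G\<^esub> \<kappa> \<longrightarrow>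
      smooth_on {\<sigma> :: 'f smooth_curve. \<forall>t\<in>{0..1}. curve_fun \<sigma> t \<in> W}
        (\<lambda>\<sigma>. Abs_smooth_curve
          (\<lambda>t. if t \<in> {0..1} then \<alpha> (\<lambda>s\<in>{0..1}. \<Phi> s (curve_fun \<sigma> s)) t \<kappa> else 0)))"

text \<open>
  The fibre over a curve \<open>c\<close> consists of the vector fields along \<open>c\<close>; it is a module over the ring of
  smooth functions on \<open>[0,1]\<close>, as is the space of curves in the Lie algebra. A \<open>1\<close>-form is linear on
  fibres with respect to these module structures (constant functions give linearity over the reals).
\<close>

definition fibre_linear ::
    "('m, 'f::real_normed_vector) chart set
      \<Rightarrow> ((real \<Rightarrow> 'm \<times> ('m, 'f) tangent) \<Rightarrow> (real \<Rightarrow> ('g, 'e::real_normed_vector) tangent)) \<Rightarrow> bool"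
  where "fibre_linear B \<alpha> \<longleftrightarrow>
    (\<forall>v\<in>curves (tangent_bundle B). \<forall>w\<in>curves (tangent_bundle B).
      (\<forall>t\<in>{0..1}. fst (v t) = fst (w t)) \<longrightarrow>
      \<alpha> (\<lambda>t\<in>{0..1}. (fst (v t), tadd (snd (v t)) (snd (w t))))
        = (\<lambda>t\<in>{0..1}. tadd (\<alpha> v t) (\<alpha> w t))) \<and>
    (\<forall>v\<in>curves (tangent_bundle B). \<forall>h :: real \<Rightarrow> real. smooth_on {0..1} h \<longrightarrow>
      \<alpha> (\<lambda>t\<in>{0..1}. (fst (v t), tscale (h t) (snd (v t))))
        = (\<lambda>t\<in>{0..1}. tscale (h t) (\<alpha> v t)))"

definition curve_one_form ::
    "('m, 'f::real_normed_vector) chart set \<Rightarrow> ('g, 'z) monoid_scheme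
      \<Rightarrow> ('g, 'e::real_normed_vector) chart set
      \<Rightarrow> ((real \<Rightarrow> 'm \<times> ('m, 'f) tangent) \<Rightarrow> (real \<Rightarrow> ('g, 'e) tangent)) \<Rightarrow> bool"
  where "curve_one_form B G A \<alpha> \<longleftrightarrow>
    smooth_curve_map (tangent_bundle B) G A \<alpha> \<and> fibre_linear B \<alpha>"

definition one_form ::
    "('m, 'f::real_normed_vector) chart set \<Rightarrow> ('g, 'z) monoid_scheme
      \<Rightarrow> ('g, 'e::real_normed_vector) chart set
      \<Rightarrow> ('m \<times> ('m, 'f) tangent \<Rightarrow> ('g, 'e) tangent) \<Rightarrow> bool" where
  "one_form B G A \<omega> \<longleftrightarrow>
    (\<forall>p\<in>manifold_set B. \<forall>v\<in>tangent_space B p.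
      \<omega> (p, v) \<in> lie_algebra G A \<and>
      (\<forall>w\<in>tangent_space B p. \<omega> (p, tadd v w) = tadd (\<omega> (p, v)) (\<omega> (p, w))) \<and>
      (\<forall>r. \<omega> (p, tscale r v) = tscale r (\<omega> (p, v)))) \<and>
    (\<forall>\<kappa>\<in>tangent_bundle B. \<forall>\<mu>. chart_at A \<one>\<^bsub>G\<^esub> \<mu> \<longrightarrow>
      smooth_on (snd \<kappa> ` fst \<kappa>) (\<lambda>y. \<omega> (chart_inv \<kappa> y) \<mu>))"

definition theta :: "('n \<Rightarrow> 'b) \<Rightarrow> (real \<Rightarrow> 'n) \<Rightarrow> real \<Rightarrow> 'b" where
  "theta \<omega> f = compose {0..1} \<omega> f"

section \<open>Reparametrisations and the square root velocity transform\<close>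

definition diff_plus :: "(real \<Rightarrow> real) set" where
  "diff_plus = {\<phi>. bij_betw \<phi> {0..1} {0..1} \<and>
    smooth_on {0..1} \<phi> \<and> smooth_on {0..1} (the_inv_into {0..1} \<phi>) \<and>
    (\<forall>t\<in>{0..1}. vector_derivative \<phi> (at t within {0..1}) > 0)}"

text \<open>
  Fibre-wise linearity alone does not let \<open>\<alpha>\<close> commute with composition: it may depend on the curve
  non-locally. Superposition operators \<open>theta \<omega>\<close> always satisfy the following condition.
\<close>

definition reparam_equivariant ::
    "('m, 'f::real_normed_vector) chart set
      \<Rightarrow> ((real \<Rightarrow> 'm \<times> ('m, 'f) tangent) \<Rightarrow> (real \<Rightarrow> ('g, 'e::real_normed_vector) tangent)) \<Rightarrow> bool"
  where "reparam_equivariant B \<alpha> \<longleftrightarrow>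
    (\<forall>v\<in>curves (tangent_bundle B). \<forall>\<phi>\<in>diff_plus.
      \<alpha> (compose {0..1} v \<phi>) = compose {0..1} (\<alpha> v) \<phi>)"

definition reparam_invariant :: "(real \<Rightarrow> 'm) set \<Rightarrow> ((real \<Rightarrow> 'm) \<Rightarrow> (real \<Rightarrow> 'm) \<Rightarrow> real) \<Rightarrow> bool" where
  "reparam_invariant P d \<longleftrightarrow>
    (\<forall>f\<in>P. \<forall>g\<in>P. \<forall>\<phi>\<in>diff_plus. d f g = d (compose {0..1} f \<phi>) (compose {0..1} g \<phi>))"

definition srvt ::
    "('g, 'z) monoid_scheme \<Rightarrow> ('g \<Rightarrow> ('g, 'e) tangent \<Rightarrow> ('g, 'e) tangent \<Rightarrow> real)
      \<Rightarrow> ('m, 'f::real_normed_vector) chart set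
      \<Rightarrow> ((real \<Rightarrow> 'm \<times> ('m, 'f) tangent) \<Rightarrow> (real \<Rightarrow> ('g, 'e::real_normed_vector) tangent))
      \<Rightarrow> (real \<Rightarrow> 'm) \<Rightarrow> real \<Rightarrow> ('g, 'e) tangent" where
  "srvt G m B \<alpha> c =
    (\<lambda>t\<in>{0..1}. tscale (1 / sqrt (lie_norm G m (\<alpha> (curve_D B c) t))) (\<alpha> (curve_D B c) t))"

definition srvt_dist ::
    "('g, 'z) monoid_scheme \<Rightarrow> ('g \<Rightarrow> ('g, 'e) tangent \<Rightarrow> ('g, 'e) tangent \<Rightarrow> real)
      \<Rightarrow> ('m, 'f::real_normed_vector) chart set
      \<Rightarrow> ((real \<Rightarrow> 'm \<times> ('m, 'f) tangent) \<Rightarrow> (real \<Rightarrow> ('g, 'e::real_normed_vector) tangent))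
      \<Rightarrow> (real \<Rightarrow> 'm) \<Rightarrow> (real \<Rightarrow> 'm) \<Rightarrow> real" where
  "srvt_dist G m B \<alpha> f g =
    sqrt (integral {0..1} (\<lambda>t. (lie_norm G m (tdiff (srvt G m B \<alpha> f t) (srvt G m B \<alpha> g t)))\<^sup>2))"

end

theory Submission
  imports Defs
begin

text \<open>
  The square root in the transform \<open>\<R>\<close> is made for the substitution rule. If \<open>\<phi>\<close> is a
  reparametrisation, then \<open>D (c \<circ> \<phi>) = \<phi>' \<cdot> (D c \<circ> \<phi>)\<close>. As soon as \<open>\<alpha>\<close> turns this chain rule into
  \<open>\<alpha> (D (c \<circ> \<phi>)) = \<phi>' \<cdot> (\<alpha> (D c) \<circ> \<phi>)\<close>, dividing by the square root of the norm gives
  \<open>\<R> (c \<circ> \<phi>) = sqrt \<phi>' \<cdot> (\<R> c \<circ> \<phi>)\<close>, so that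
  \<open>\<parallel>\<R> (f \<circ> \<phi>) - \<R> (g \<circ> \<phi>)\<parallel>\<^sup>2 = \<phi>' \<cdot> (\<parallel>\<R> f - \<R> g\<parallel>\<^sup>2 \<circ> \<phi>)\<close>, whose integral over \<open>[0,1]\<close> is that of
  \<open>\<parallel>\<R> f - \<R> g\<parallel>\<^sup>2\<close> (\<open>srvt_dist_reparametrise\<close>).

  The equation for \<open>\<alpha>\<close> comes from homogeneity. For a \<open>1\<close>-form on curves that commutes with
  reparametrisation, the factor \<open>\<phi>'\<close> is a smooth function on \<open>[0,1]\<close> and may be pulled out of \<open>\<alpha>\<close>
  (\<open>fibre_linear_chain\<close>); for a superposition operator \<open>theta \<omega>\<close> it may be pulled out of \<open>\<omega>\<close> at
  every single time (\<open>theta_chain\<close>).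

  What remains is to know that all curves involved lie in the domain of \<open>\<alpha>\<close>, the smooth curves in
  the tangent bundle: that \<open>D c\<close> is one (\<open>curve_D_in_curves\<close>), and that such curves may be
  reparametrised (\<open>compose_in_curves\<close>). This takes two pieces of calculus. For functions of one
  real variable on a set without isolated points, Bastiani smoothness is the existence of derivatives
  of all orders, which yields the smoothness of derivatives and composites. For maps on an open
  subset of a finite-dimensional space, Bastiani smoothness implies Frechet differentiability
  (\<open>smooth_on_open_imp_differentiable\<close>); through the chain rule it makes the coordinate vectors of a
  velocity transform as those of a tangent vector do, and it makes the tangent spaces linear.
\<close>

section \<open>Smooth functions of one real variable\<close>

lemma has_vector_derivative_iff_difference_quotient:
  fixes f :: "real \<Rightarrow> 'b::real_normed_vector"
  shows "(f has_vector_derivative D) (at x within S) \<longleftrightarrow>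
    ((\<lambda>h. (1 / h) *\<^sub>R (f (x + h) - f x)) \<longlongrightarrow> D) (at 0 within {h. x + h \<in> S})"
proof -
  have "(f has_vector_derivative D) (at x within S) \<longleftrightarrow>
      ((\<lambda>y. (1 / (y - x)) *\<^sub>R (f y - f x)) \<longlongrightarrow> D) (at x within S)"
  proof -
    \<comment> \<open>the remainder quotient and the error of the difference quotient differ by a sign\<close>
    have eq: "(1 / norm (y - x)) *\<^sub>R (f y - (f x + (y - x) *\<^sub>R D)) =
        sgn (y - x) *\<^sub>R ((1 / (y - x)) *\<^sub>R (f y - f x) - D)" for y
    proof (cases "y = x")
      case False
      then have "f y - (f x + (y - x) *\<^sub>R D) = (y - x) *\<^sub>R ((1 / (y - x)) *\<^sub>R (f y - f x) - D)"
        by (simp add: scaleR_diff_right[of "y - x"])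
      then show ?thesis using False by (simp add: real_sgn_eq)
    qed simp
    have "(f has_vector_derivative D) (at x within S) \<longleftrightarrow>
        ((\<lambda>y. sgn (y - x) *\<^sub>R ((1 / (y - x)) *\<^sub>R (f y - f x) - D)) \<longlongrightarrow> 0) (at x within S)"
      unfolding has_vector_derivative_def has_derivative_within eq
      by (simp add: bounded_linear_scaleR_left)
    also have "\<dots> \<longleftrightarrow> ((\<lambda>y. norm (sgn (y - x) *\<^sub>R ((1 / (y - x)) *\<^sub>R (f y - f x) - D))) \<longlongrightarrow> 0)
        (at x within S)"
      by (rule tendsto_norm_zero_iff[symmetric])
    also have "\<dots> \<longleftrightarrow> ((\<lambda>y. norm ((1 / (y - x)) *\<^sub>R (f y - f x) - D)) \<longlongrightarrow> 0) (at x within S)"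
      by (rule filterlim_cong) (simp_all add: eventually_at_filter abs_sgn_eq)
    also have "\<dots> \<longleftrightarrow> ((\<lambda>y. (1 / (y - x)) *\<^sub>R (f y - f x)) \<longlongrightarrow> D) (at x within S)"
      by (simp only: tendsto_norm_zero_iff LIM_zero_iff)
    finally show ?thesis .
  qed
  moreover have eq: "at x within S = filtermap ((+) x) (at 0 within {h. x + h \<in> S})"
  proof -
    have "(\<forall>y\<in>S. y \<noteq> x \<and> dist y x < d \<longrightarrow> P y) \<longleftrightarrow>
        (\<forall>h\<in>{h. x + h \<in> S}. h \<noteq> 0 \<and> dist h 0 < d \<longrightarrow> P (x + h))"
      (is "?L \<longleftrightarrow> ?R") for d P
    proof
      assume ?R
      show ?L
      proof (intro ballI impI)
        fix y assume "y \<in> S" "y \<noteq> x \<and> dist y x < d"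
        with \<open>?R\<close>[rule_format, of "y - x"] show "P y" by (simp add: dist_norm)
      qed
    qed (simp add: dist_norm)
    then show ?thesis by (simp add: filter_eq_iff eventually_filtermap eventually_at)
  qed
  moreover have "((\<lambda>y. (1 / (y - x)) *\<^sub>R (f y - f x)) \<longlongrightarrow> D) (at x within S) \<longleftrightarrow>
      ((\<lambda>h. (1 / h) *\<^sub>R (f (x + h) - f x)) \<longlongrightarrow> D) (at 0 within {h. x + h \<in> S})"
    unfolding eq by (simp add: filterlim_filtermap)
  ultimately show ?thesis by blast
qed

text \<open>
  The derivatives are existential witnesses, so that the closure properties below hold on any set
  by induction on the order, also at isolated points, where derivatives are not unique.
\<close>

primrec times_differentiable :: "nat \<Rightarrow> real set \<Rightarrow> (real \<Rightarrow> 'b::real_normed_vector) \<Rightarrow> bool" where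
  "times_differentiable 0 S f \<longleftrightarrow> True"
| "times_differentiable (Suc n) S f \<longleftrightarrow>
    (\<exists>f'. (\<forall>x\<in>S. (f has_vector_derivative f' x) (at x within S)) \<and> times_differentiable n S f')"

lemma smooth_on_cong:
  assumes "smooth_on S f" "\<And>x. x \<in> S \<Longrightarrow> f x = g x"
  shows "smooth_on S g"
  using assms unfolding smooth_on_def by auto

lemma smooth_on_subset:
  assumes "smooth_on S f" "T \<subseteq> S"
  shows "smooth_on T f"
proof -
  obtain d where d: "\<forall>x\<in>S. \<forall>v. d 0 x v = f x"
      "\<forall>k. \<forall>x\<in>S. \<forall>v. ((\<lambda>h::real. (1 / h) *\<^sub>R (d k (x + h *\<^sub>R v k) v - d k x v)) \<longlongrightarrow> d (Suc k) x v)
          (at 0 within {h. x + h *\<^sub>R v k \<in> S})"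
      "\<forall>k. continuous_on (S \<times> UNIV) (\<lambda>(x, v). d k x v)"
    using assms(1) unfolding smooth_on_def by blast
  show ?thesis
    unfolding smooth_on_def
  proof (intro exI[of _ d] conjI allI ballI)
    fix k x v assume "x \<in> T"
    then show "((\<lambda>h::real. (1 / h) *\<^sub>R (d k (x + h *\<^sub>R v k) v - d k x v)) \<longlongrightarrow> d (Suc k) x v)
          (at 0 within {h. x + h *\<^sub>R v k \<in> T})"
      using assms(2) by (intro tendsto_within_subset[OF d(2)[rule_format]]) auto
  next
    fix k show "continuous_on (T \<times> UNIV) (\<lambda>(x, v). d k x v)"
      using assms(2) by (intro continuous_on_subset[OF d(3)[rule_format]]) auto
  qed (use assms d in auto)
qed

lemma times_differentiable_cong:
  assumes "times_differentiable n S f" "\<And>x. x \<in> S \<Longrightarrow> f x = g x"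
  shows "times_differentiable n S g"
proof (cases n)
  case (Suc k)
  then obtain f' where "\<forall>x\<in>S. (f has_vector_derivative f' x) (at x within S)"
      "times_differentiable k S f'"
    using assms(1) by auto
  then show ?thesis
    using assms(2) has_vector_derivative_transform[of _ S g f] by (auto simp: Suc intro!: exI[of _ f'])
qed simp

lemma times_differentiable_Suc_imp:
  "times_differentiable (Suc n) S f \<Longrightarrow> times_differentiable n S f"
proof (induction n arbitrary: f)
  case (Suc n)
  from Suc.prems obtain f' where "\<forall>x\<in>S. (f has_vector_derivative f' x) (at x within S)"
      "times_differentiable (Suc n) S f'"
    by (subst (asm) times_differentiable.simps(2)) blast
  with Suc.IH[of f'] show ?case by auto
qed simp

text \<open>The iterated derivatives in direction \<open>1\<close> are the successive derivatives.\<close>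

lemma smooth_on_imp_times_differentiable:
  fixes f :: "real \<Rightarrow> 'b::real_normed_vector"
  assumes "smooth_on S f"
  shows "times_differentiable n S f"
proof -
  obtain d where d: "\<And>x v. x \<in> S \<Longrightarrow> d 0 x v = f x"
      "\<And>k x v. x \<in> S \<Longrightarrow> ((\<lambda>h::real. (1 / h) *\<^sub>R (d k (x + h *\<^sub>R v k) v - d k x v)) \<longlongrightarrow> d (Suc k) x v)
          (at 0 within {h. x + h *\<^sub>R v k \<in> S})"
    using assms unfolding smooth_on_def by blast
  define F where "F k x = d k x (\<lambda>_. 1)" for k x
  have der: "(F k has_vector_derivative F (Suc k) x) (at x within S)" if "x \<in> S" for k x
    using d(2)[OF that, of k "\<lambda>_. 1"]
    by (simp add: has_vector_derivative_iff_difference_quotient F_def)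
  have "times_differentiable n S (F k)" for n k
    by (induction n arbitrary: k) (use der in auto)
  then show ?thesis
    by (rule times_differentiable_cong[of _ _ "F 0"]) (simp add: F_def d(1))
qed

text \<open>
  Conversely, the iterated directional derivatives of \<open>f\<close> must be
  \<open>v 0 \<cdot> \<dots> \<cdot> v (k - 1) \<cdot> f\<^sup>(\<^sup>k\<^sup>) x\<close>. Without isolated points derivatives are unique, so that the
  finite towers of derivatives of \<open>f\<close> are initial parts of a single infinite one.
\<close>

lemma smooth_on_if_times_differentiable:
  fixes f :: "real \<Rightarrow> 'b::real_normed_vector"
  assumes perfect: "\<And>x. x \<in> S \<Longrightarrow> x islimpt S"
    and f: "\<And>n. times_differentiable n S f"
  shows "smooth_on S f"
proof -
  define F where "F k = ((\<lambda>u x. vector_derivative u (at x within S)) ^^ k) f" for k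
  have F: "times_differentiable n S (F k)" for n k :: nat
  proof (induction k arbitrary: n)
    case (Suc k)
    obtain u where u: "\<forall>x\<in>S. (F k has_vector_derivative u x) (at x within S)"
        "times_differentiable n S u"
      using Suc[of "Suc n"] by auto
    have "u x = F (Suc k) x" if "x \<in> S" for x
      using u(1) that perfect[OF that]
      by (auto simp: F_def trivial_limit_within intro!: vector_derivative_within[symmetric])
    with u(2) show ?case by (rule times_differentiable_cong)
  qed (simp add: F_def f)
  have der: "(F k has_vector_derivative F (Suc k) x) (at x within S)" if "x \<in> S" for k x
  proof -
    obtain u where "\<forall>x\<in>S. (F k has_vector_derivative u x) (at x within S)"
      using F[of "Suc 0" k] by auto
    then show ?thesis
      using that perfect[OF that]
      by (auto simp: F_def trivial_limit_within vector_derivative_within)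
  qed
  have cont: "continuous_on S (F k)" for k
    using der by (auto simp: continuous_on_eq_continuous_within intro: has_vector_derivative_continuous)
  show ?thesis
    unfolding smooth_on_def
  proof (intro exI[of _ "\<lambda>k x v. (\<Prod>i<k. v i) *\<^sub>R F k x"] conjI allI ballI)
    fix k :: nat and x v assume x: "x \<in> S"
    let ?p = "\<Prod>i<k. v i" and ?S = "{h. x + h *\<^sub>R v k \<in> S}"
    have "((\<lambda>h. F k (x + h *\<^sub>R v k)) has_vector_derivative v k *\<^sub>R F (Suc k) x) (at 0 within ?S)"
    proof -
      have "((F k \<circ> (\<lambda>h. x + h *\<^sub>R v k)) has_vector_derivative v k *\<^sub>R F (Suc k) x) (at 0 within ?S)"
        by (rule vector_diff_chain_within)
          (auto intro!: derivative_eq_intros has_vector_derivative_within_subset[OF der] x)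
      then show ?thesis by (simp add: o_def)
    qed
    then have "((\<lambda>h. ?p *\<^sub>R F k (x + h *\<^sub>R v k)) has_vector_derivative ?p *\<^sub>R v k *\<^sub>R F (Suc k) x)
        (at 0 within ?S)"
      by (auto intro!: derivative_eq_intros)
    then show "((\<lambda>h::real. (1 / h) *\<^sub>R (?p *\<^sub>R F k (x + h *\<^sub>R v k) - ?p *\<^sub>R F k x)) \<longlongrightarrow>
        (\<Prod>i<Suc k. v i) *\<^sub>R F (Suc k) x) (at 0 within ?S)"
      by (simp add: has_vector_derivative_iff_difference_quotient)
  next
    fix k :: nat
    have "continuous_on (S \<times> UNIV) (\<lambda>z::real \<times> (nat \<Rightarrow> real). (\<Prod>i<k. snd z i) *\<^sub>R F k (fst z))"
      by (intro continuous_intros continuous_on_compose2[OF cont]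
            continuous_on_product_then_coordinatewise) auto
    then show "continuous_on (S \<times> UNIV) (\<lambda>(x, v). (\<Prod>i<k. v i) *\<^sub>R F k x)"
      by (simp add: case_prod_unfold)
  qed (auto simp: F_def)
qed

lemma times_differentiable_add:
  assumes "times_differentiable n S f" "times_differentiable n S g"
  shows "times_differentiable n S (\<lambda>x. f x + g x)"
  using assms
proof (induction n arbitrary: f g)
  case (Suc n)
  then obtain f' g' where "\<forall>x\<in>S. (f has_vector_derivative f' x) (at x within S)"
      "\<forall>x\<in>S. (g has_vector_derivative g' x) (at x within S)"
      "times_differentiable n S f'" "times_differentiable n S g'"
    by auto
  then show ?case
    using Suc.IH by (auto intro!: exI[of _ "\<lambda>x. f' x + g' x"] has_vector_derivative_add)
qed simp

lemma times_differentiable_scaleR: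
  fixes a :: "real \<Rightarrow> real"
  assumes "times_differentiable n S a" "times_differentiable n S f"
  shows "times_differentiable n S (\<lambda>x. a x *\<^sub>R f x)"
  using assms
proof (induction n arbitrary: a f)
  case (Suc n)
  then obtain a' f' where "\<forall>x\<in>S. (a has_vector_derivative a' x) (at x within S)"
      "\<forall>x\<in>S. (f has_vector_derivative f' x) (at x within S)"
      "times_differentiable n S a'" "times_differentiable n S f'"
    by auto
  moreover have "times_differentiable n S a" "times_differentiable n S f"
    using Suc.prems times_differentiable_Suc_imp by blast+
  ultimately show ?case
    using Suc.IH
    by (auto intro!: exI[of _ "\<lambda>x. a x *\<^sub>R f' x + a' x *\<^sub>R f x"] times_differentiable_add
        has_vector_derivative_scaleR simp: has_real_derivative_iff_has_vector_derivative)
qed simp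

lemma times_differentiable_compose:
  fixes \<phi> :: "real \<Rightarrow> real"
  assumes "times_differentiable n S f" "times_differentiable n T \<phi>" "\<phi> ` T \<subseteq> S"
  shows "times_differentiable n T (f \<circ> \<phi>)"
  using assms(1,2)
proof (induction n arbitrary: f)
  case (Suc n)
  then obtain f' \<phi>' where *: "\<forall>x\<in>S. (f has_vector_derivative f' x) (at x within S)"
      "\<forall>x\<in>T. (\<phi> has_vector_derivative \<phi>' x) (at x within T)"
      "times_differentiable n S f'" "times_differentiable n T \<phi>'"
    by auto
  have "((f \<circ> \<phi>) has_vector_derivative \<phi>' x *\<^sub>R (f' \<circ> \<phi>) x) (at x within T)" if "x \<in> T" for x
    using vector_diff_chain_within[of \<phi> "\<phi>' x" x T f "f' (\<phi> x)"] * that assms(3)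
      has_vector_derivative_within_subset[of f "f' (\<phi> x)" "\<phi> x" S "\<phi> ` T"]
    by auto
  moreover have "times_differentiable n T (\<lambda>x. \<phi>' x *\<^sub>R (f' \<circ> \<phi>) x)"
    using Suc.IH[of f'] Suc.prems(2) times_differentiable_Suc_imp *
    by (intro times_differentiable_scaleR) auto
  ultimately show ?case
    unfolding times_differentiable.simps by (intro exI[of _ "\<lambda>x. \<phi>' x *\<^sub>R (f' \<circ> \<phi>) x"]) simp
qed simp

lemma times_differentiable_Pair:
  assumes "times_differentiable n S f" "times_differentiable n S g"
  shows "times_differentiable n S (\<lambda>x. (f x, g x))"
  using assms
proof (induction n arbitrary: f g)
  case (Suc n)
  then obtain f' g' where "\<forall>x\<in>S. (f has_vector_derivative f' x) (at x within S)"
      "\<forall>x\<in>S. (g has_vector_derivative g' x) (at x within S)"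
      "times_differentiable n S f'" "times_differentiable n S g'"
    by auto
  then show ?case
    using Suc.IH by (auto intro!: exI[of _ "\<lambda>x. (f' x, g' x)"] has_vector_derivative_Pair)
qed simp

lemma smooth_on_compose_real:
  fixes f :: "real \<Rightarrow> 'b::real_normed_vector" and \<phi> :: "real \<Rightarrow> real"
  assumes "smooth_on S f" "smooth_on T \<phi>" "\<phi> ` T \<subseteq> S" "\<And>x. x \<in> T \<Longrightarrow> x islimpt T"
  shows "smooth_on T (f \<circ> \<phi>)"
proof (rule smooth_on_if_times_differentiable[OF assms(4)])
  show "times_differentiable n T (f \<circ> \<phi>)" for n
    using assms(1,2)[THEN smooth_on_imp_times_differentiable] assms(3)
    by (rule times_differentiable_compose)
qed

lemma smooth_on_vector_derivative:
  fixes f :: "real \<Rightarrow> 'b::real_normed_vector"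
  assumes "smooth_on S f" and perfect: "\<And>x. x \<in> S \<Longrightarrow> x islimpt S"
  shows "smooth_on S (\<lambda>x. vector_derivative f (at x within S))"
proof (rule smooth_on_if_times_differentiable[OF perfect])
  fix n
  obtain f' where f': "\<forall>x\<in>S. (f has_vector_derivative f' x) (at x within S)" "times_differentiable n S f'"
    using smooth_on_imp_times_differentiable[OF assms(1), of "Suc n"] by auto
  have "f' x = vector_derivative f (at x within S)" if "x \<in> S" for x
    using f'(1) that perfect[OF that]
    by (auto simp: trivial_limit_within intro!: vector_derivative_within[symmetric])
  with f'(2) show "times_differentiable n S (\<lambda>x. vector_derivative f (at x within S))"
    by (rule times_differentiable_cong)
qed

lemma smooth_on_Pair_real:
  fixes f :: "real \<Rightarrow> 'b::real_normed_vector" and g :: "real \<Rightarrow> 'c::real_normed_vector"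
  assumes "smooth_on S f" "smooth_on S g" "\<And>x. x \<in> S \<Longrightarrow> x islimpt S"
  shows "smooth_on S (\<lambda>x. (f x, g x))"
  by (rule smooth_on_if_times_differentiable[OF assms(3)
        times_differentiable_Pair[OF assms(1,2)[THEN smooth_on_imp_times_differentiable]]])

lemma smooth_on_has_vector_derivative:
  fixes f :: "real \<Rightarrow> 'b::real_normed_vector"
  assumes "smooth_on S f" "x \<in> S" "x islimpt S"
  shows "(f has_vector_derivative vector_derivative f (at x within S)) (at x within S)"
proof -
  obtain f' where f': "\<forall>x\<in>S. (f has_vector_derivative f' x) (at x within S)"
    using smooth_on_imp_times_differentiable[OF assms(1), of "Suc 0"] by auto
  then show ?thesis
    using assms(2,3) vector_derivative_within[of x S f "f' x"] by (auto simp: trivial_limit_within)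
qed

section \<open>Bastiani smooth maps are Frechet differentiable in finite dimension\<close>

lemma smooth_on_open_directional_derivative:
  fixes f :: "'a::real_normed_vector \<Rightarrow> 'b::real_normed_vector"
  assumes "open U" "smooth_on U f"
  obtains D where "\<And>x v. x \<in> U \<Longrightarrow> ((\<lambda>h. f (x + h *\<^sub>R v)) has_vector_derivative D x v) (at 0)"
    "continuous_on (U \<times> UNIV) (\<lambda>(x, v). D x v)"
proof -
  obtain d where d: "\<And>x v. x \<in> U \<Longrightarrow> d 0 x v = f x"
      "\<And>k x v. x \<in> U \<Longrightarrow> ((\<lambda>h::real. (1 / h) *\<^sub>R (d k (x + h *\<^sub>R v k) v - d k x v)) \<longlongrightarrow> d (Suc k) x v)
          (at 0 within {h. x + h *\<^sub>R v k \<in> U})"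
      "\<And>k. continuous_on (U \<times> UNIV) (\<lambda>(x, v :: nat \<Rightarrow> 'a). d k x v)"
    using assms(2) unfolding smooth_on_def by blast
  show thesis
  proof
    fix x v assume x: "x \<in> U"
    let ?S = "{h. x + h *\<^sub>R v \<in> U}"
    have "((\<lambda>h. d 0 (x + h *\<^sub>R v) (\<lambda>_. v)) has_vector_derivative d 1 x (\<lambda>_. v)) (at 0 within ?S)"
      using d(2)[OF x, of 0 "\<lambda>_. v"] by (simp add: has_vector_derivative_iff_difference_quotient)
    then have "((\<lambda>h. f (x + h *\<^sub>R v)) has_vector_derivative d 1 x (\<lambda>_. v)) (at 0 within ?S)"
      by (rule has_vector_derivative_transform[rotated -1]) (use x in \<open>auto simp: d(1)\<close>)
    moreover have "open ?S"
      using open_vimage[OF assms(1), of "\<lambda>h. x + h *\<^sub>R v"] by (simp add: vimage_def continuous_intros)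
    then have "at 0 within ?S = at 0"
      using x by (intro at_within_open) auto
    ultimately show "((\<lambda>h. f (x + h *\<^sub>R v)) has_vector_derivative d 1 x (\<lambda>_. v)) (at 0)"
      by simp
  next
    have "continuous_on (U \<times> UNIV) ((\<lambda>(x, v). d 1 x v) \<circ> (\<lambda>(x, v). (x, \<lambda>_. v)))"
      by (rule continuous_on_compose[OF _ continuous_on_subset[OF d(3)]])
        (auto simp: case_prod_unfold intro!: continuous_intros)
    then show "continuous_on (U \<times> UNIV) (\<lambda>(x, v). d 1 x (\<lambda>_. v))"
      by (simp add: o_def case_prod_unfold)
  qed
qed

text \<open>
  Since the unit sphere is compact, the directional derivative is continuous uniformly in the unit
  direction, and the mean value inequality along segments makes \<open>f\<close> strictly differentiable. Strict
  differentiability compares \<open>f\<close> at two points near \<open>x\<close>, neither of which has to be \<open>x\<close>; this also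
  gives additivity in the direction, by going from \<open>x\<close> to \<open>x + h (u + v)\<close> via \<open>x + h u\<close>.
\<close>

lemma smooth_on_open_imp_differentiable:
  fixes f :: "'a::{real_normed_vector,heine_borel} \<Rightarrow> 'b::real_normed_vector"
  assumes "open U" "smooth_on U f" "x \<in> U"
  shows "f differentiable (at x)"
proof -
  obtain D where D: "\<And>x v. x \<in> U \<Longrightarrow> ((\<lambda>h. f (x + h *\<^sub>R v)) has_vector_derivative D x v) (at 0)"
    and cont: "continuous_on (U \<times> UNIV) (\<lambda>(x, v). D x v)"
    using smooth_on_open_directional_derivative[OF assms(1,2)] by blast
  have compact_sphere: "compact (sphere (0::'a) 1)"
    unfolding sphere_def using compact_eq_bounded_closed[of "{v::'a. norm v = 1}"]
    by (auto simp: bounded_iff dist_norm intro!: closed_Collect_eq continuous_intros)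
  have line: "((\<lambda>s. f (y + s *\<^sub>R w)) has_vector_derivative D (y + s *\<^sub>R w) w) (at s)"
    if "y + s *\<^sub>R w \<in> U" for y w s
  proof -
    have "((\<lambda>r. r - s) has_vector_derivative 1) (at s)"
      by (auto intro!: derivative_eq_intros)
    from vector_diff_chain_at[OF this, of "\<lambda>h. f ((y + s *\<^sub>R w) + h *\<^sub>R w)"] D[OF that, of w]
    show ?thesis by (simp add: o_def algebra_simps)
  qed
  have homogeneous: "D y (r *\<^sub>R v) = r *\<^sub>R D y v" if "y \<in> U" for y r v
  proof -
    have "((\<lambda>h. h * r) has_vector_derivative r) (at 0)"
      by (auto intro!: derivative_eq_intros)
    from vector_diff_chain_at[OF this, of "\<lambda>h. f (y + h *\<^sub>R v)"] D[OF that, of v]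
    have "((\<lambda>h. f (y + h *\<^sub>R r *\<^sub>R v)) has_vector_derivative r *\<^sub>R D y v) (at 0)"
      by (simp add: o_def)
    with D[OF that, of "r *\<^sub>R v"] show ?thesis by (rule vector_derivative_unique_at)
  qed
  have strict: "\<exists>\<delta>>0. \<forall>y w. y \<in> ball x \<delta> \<longrightarrow> y + w \<in> ball x \<delta> \<longrightarrow>
      norm (f (y + w) - f y - D x w) \<le> e * norm w" if e: "e > 0" for e
  proof -
    obtain r where r: "r > 0" "cball x r \<subseteq> U"
      using assms(1,3) open_contains_cball by blast
    define K where "K = cball x r \<times> sphere (0::'a) 1"
    have "uniformly_continuous_on K (\<lambda>(x, v). D x v)"
      by (rule compact_uniformly_continuous[OF continuous_on_subset[OF cont]])
        (use r in \<open>auto simp: K_def intro!: compact_Times compact_sphere\<close>)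
    then obtain \<delta> where \<delta>: "\<delta> > 0" "\<And>z z'. z \<in> K \<Longrightarrow> z' \<in> K \<Longrightarrow> dist z' z < \<delta> \<Longrightarrow>
        dist (case_prod D z') (case_prod D z) < e"
      using e unfolding uniformly_continuous_on_def by metis
    have "norm (f (y + w) - f y - D x w) \<le> e * norm w"
      if y: "y \<in> ball x (min \<delta> r)" "y + w \<in> ball x (min \<delta> r)" for y w
    proof -
      have seg: "y + s *\<^sub>R w \<in> ball x (min \<delta> r)" if "s \<in> {0..1}" for s
      proof -
        have "y + s *\<^sub>R w = (1 - s) *\<^sub>R y + s *\<^sub>R (y + w)" by (simp add: algebra_simps)
        then show ?thesis using convexD_alt[OF convex_ball y, of s] that by simp
      qed
      have bound: "norm (D (y + s *\<^sub>R w) w - D x w) \<le> e * norm w" if "s \<in> {0..1}" for s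
      proof (cases "w = 0")
        case True
        have "y + s *\<^sub>R w \<in> U" using seg[OF that] r by auto
        then show ?thesis using homogeneous[of _ 0 0] assms(3) True by simp
      next
        case False
        define u where "u = (1 / norm w) *\<^sub>R w"
        have u: "norm u = 1" "w = norm w *\<^sub>R u" using False by (auto simp: u_def)
        have "dist (D (y + s *\<^sub>R w) u) (D x u) < e"
          using \<delta>(2)[of "(x, u)" "(y + s *\<^sub>R w, u)"] seg[OF that] u r
          by (auto simp: K_def dist_Pair_Pair dist_commute)
        moreover have "D (y + s *\<^sub>R w) w - D x w = norm w *\<^sub>R (D (y + s *\<^sub>R w) u - D x u)"
          using homogeneous[of _ "norm w" u] u(2) seg[OF that] r assms(3)
          by (metis ball_subset_cball min.cobounded2 scaleR_diff_right subset_ball subsetD)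
        ultimately show ?thesis
          by (simp add: dist_norm mult.commute[of e] mult_left_mono)
      qed
      define g where "g s = f (y + s *\<^sub>R w) - s *\<^sub>R D x w" for s
      have "norm (g 1 - g 0) \<le> e * norm w * norm (1 - 0 :: real)"
      proof (rule differentiable_bound[of "{0..1}"])
        fix s :: real assume s: "s \<in> {0..1}"
        then have "y + s *\<^sub>R w \<in> U" using seg[OF s] r by auto
        from line[OF this]
        have "(g has_vector_derivative D (y + s *\<^sub>R w) w - D x w) (at s)"
          unfolding g_def by (auto intro!: derivative_eq_intros)
        then show "(g has_derivative (\<lambda>h. h *\<^sub>R (D (y + s *\<^sub>R w) w - D x w))) (at s within {0..1})"
          unfolding has_vector_derivative_def by (rule has_derivative_at_withinI)
        show "onorm (\<lambda>h. h *\<^sub>R (D (y + s *\<^sub>R w) w - D x w)) \<le> e * norm w"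
          using bound[OF s] e by (intro onorm_bound) (auto simp: mult.commute[of "e * norm w"] intro: mult_left_mono)
      qed auto
      then show ?thesis by (simp add: g_def algebra_simps)
    qed
    then show ?thesis using \<delta>(1) r(1) by (intro exI[of _ "min \<delta> r"]) auto
  qed
  have additive: "D x (u + v) = D x u + D x v" for u v
  proof -
    define c where "c = norm (u + v) + norm u + norm v"
    have bound: "norm (D x (u + v) - D x u - D x v) \<le> e * c" if e: "e > 0" for e
    proof -
      obtain \<delta> where \<delta>: "\<delta> > 0" "\<And>y w. y \<in> ball x \<delta> \<Longrightarrow> y + w \<in> ball x \<delta> \<Longrightarrow>
          norm (f (y + w) - f y - D x w) \<le> e * norm w"
        using strict[OF e] by blast
      \<comment> \<open>this \<open>h\<close> keeps \<open>x\<close>, \<open>x + h u\<close> and \<open>x + h (u + v)\<close> within distance \<open>\<delta>\<close> of \<open>x\<close>\<close>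
      define h where "h = \<delta> / (1 + c)"
      have "c \<ge> 0" by (simp add: c_def)
      then have h: "h > 0" "h * c < \<delta>"
        using \<delta>(1) by (auto simp: h_def field_simps)
      have small: "norm (h *\<^sub>R z) < \<delta>" if "norm z \<le> c" for z
        using le_less_trans[OF mult_left_mono[OF that, of h] h(2)] h(1) by simp
      have 1: "norm (f (x + h *\<^sub>R u) - f x - D x (h *\<^sub>R u)) \<le> e * norm (h *\<^sub>R u)"
        using small[of u] \<delta>(1) by (intro \<delta>(2)) (auto simp: dist_norm c_def)
      have 2: "norm (f (x + h *\<^sub>R (u + v)) - f x - D x (h *\<^sub>R (u + v))) \<le> e * norm (h *\<^sub>R (u + v))"
        using small[of "u + v"] \<delta>(1) by (intro \<delta>(2)) (auto simp: dist_norm c_def)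
      have 3: "norm (f ((x + h *\<^sub>R u) + h *\<^sub>R v) - f (x + h *\<^sub>R u) - D x (h *\<^sub>R v)) \<le> e * norm (h *\<^sub>R v)"
      proof (rule \<delta>(2))
        have "(x + h *\<^sub>R u) + h *\<^sub>R v = x + h *\<^sub>R (u + v)" by (simp add: algebra_simps)
        then show "(x + h *\<^sub>R u) + h *\<^sub>R v \<in> ball x \<delta>"
          using small[of "u + v"] by (simp add: dist_norm c_def)
      qed (use small[of u] in \<open>auto simp: dist_norm c_def\<close>)
      have "h * norm (D x (u + v) - D x u - D x v) =
          norm (D x (h *\<^sub>R (u + v)) - D x (h *\<^sub>R u) - D x (h *\<^sub>R v))"
        using h(1) by (simp only: homogeneous[OF assms(3)] norm_scaleR abs_of_pos flip: scaleR_diff_right)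
      also have "\<dots> = norm ((f (x + h *\<^sub>R u) - f x - D x (h *\<^sub>R u))
          + (f ((x + h *\<^sub>R u) + h *\<^sub>R v) - f (x + h *\<^sub>R u) - D x (h *\<^sub>R v))
          - (f (x + h *\<^sub>R (u + v)) - f x - D x (h *\<^sub>R (u + v))))"
        by (rule arg_cong[where f = norm]) (simp add: scaleR_add_right add.assoc)
      also have "\<dots> \<le> e * norm (h *\<^sub>R u) + e * norm (h *\<^sub>R v) + e * norm (h *\<^sub>R (u + v))"
        by (intro norm_triangle_le_diff add_mono norm_triangle_le 1 2 3)
      also have "\<dots> = h * (e * c)"
        using h(1) by (simp add: c_def distrib_left mult.left_commute[of e])
      finally show ?thesis using h(1) by simp
    qed
    have "norm (D x (u + v) - D x u - D x v) \<le> 0 + e" if "e > 0" for e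
    proof -
      have "c \<ge> 0" by (simp add: c_def)
      then have "e / (1 + c) * c \<le> e" "e / (1 + c) > 0"
        using that by (simp_all add: field_simps)
      with bound[of "e / (1 + c)"] show ?thesis by simp
    qed
    then have "norm (D x (u + v) - D x u - D x v) \<le> 0"
      by (rule field_le_epsilon)
    then show ?thesis by (simp add: algebra_simps)
  qed
  have "bounded_linear (D x)"
  proof -
    have "continuous_on (sphere 0 1) ((\<lambda>(x, v). D x v) \<circ> Pair x)"
      by (rule continuous_on_compose[OF _ continuous_on_subset[OF cont]])
        (use assms(3) in \<open>auto intro!: continuous_intros\<close>)
    then have "compact (D x ` sphere 0 1)"
      by (intro compact_continuous_image) (auto simp: o_def intro: compact_sphere)
    then have "bounded (D x ` sphere 0 1)"
      by (rule compact_imp_bounded)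
    then obtain C where "\<forall>y\<in>D x ` sphere 0 1. norm y \<le> C"
      unfolding bounded_iff by blast
    then have C: "norm (D x u) \<le> C" if "norm u = 1" for u
      using that by simp
    have "norm (D x v) \<le> norm v * C" for v
    proof (cases "v = 0")
      case False
      then have "norm (D x ((1 / norm v) *\<^sub>R v)) \<le> C" by (intro C) simp
      with False show ?thesis by (simp add: homogeneous[OF assms(3)] field_simps)
    qed (use homogeneous[OF assms(3), of 0 0] in simp)
    then show ?thesis
      by (intro bounded_linear_intro additive homogeneous assms(3))
  qed
  moreover have "\<exists>d>0. \<forall>y. norm (y - x) < d \<longrightarrow> norm (f y - f x - D x (y - x)) \<le> e * norm (y - x)"
    if e: "e > 0" for e
  proof -
    obtain \<delta> where \<delta>: "\<delta> > 0" "\<And>y w. y \<in> ball x \<delta> \<Longrightarrow> y + w \<in> ball x \<delta> \<Longrightarrow>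
        norm (f (y + w) - f y - D x w) \<le> e * norm w"
      using strict[OF e] by blast
    show ?thesis
      using \<delta>(1) \<delta>(2)[of x "y - x" for y] by (intro exI[of _ \<delta>]) (auto simp: dist_norm norm_minus_commute)
  qed
  ultimately have "(f has_derivative D x) (at x)"
    by (simp add: has_derivative_within_alt)
  then show ?thesis by (auto simp: differentiable_def)
qed

section \<open>Tangent spaces and velocities\<close>

lemma chart_inv_coord:
  assumes "manifold B" "\<kappa> \<in> B" "p \<in> fst \<kappa>"
  shows "chart_inv \<kappa> (snd \<kappa> p) = p"
  using assms by (auto simp: manifold_def chart_inv_def intro!: the_inv_into_f_f)

lemma chart_transition_differentiable:
  fixes B :: "('m, 'f::{real_normed_vector,heine_borel}) chart set"
  assumes "manifold B" "chart_at B p \<kappa>" "chart_at B p \<mu>"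
  shows "(snd \<mu> \<circ> chart_inv \<kappa>) differentiable (at (snd \<kappa> p))"
  using assms
  by (intro smooth_on_open_imp_differentiable[of "snd \<kappa> ` (fst \<kappa> \<inter> fst \<mu>)"])
    (auto simp: manifold_def chart_at_def)

lemma chart_transition_linear:
  fixes B :: "('m, 'f::{real_normed_vector,heine_borel}) chart set"
  assumes "manifold B" "chart_at B p \<kappa>" "chart_at B p \<mu>"
  shows "linear (frechet_derivative (snd \<mu> \<circ> chart_inv \<kappa>) (at (snd \<kappa> p)))"
  by (rule linear_frechet_derivative[OF chart_transition_differentiable[OF assms]])

lemma tangent_spaceD:
  assumes "v \<in> tangent_space B p"
  shows "\<not> chart_at B p \<kappa> \<Longrightarrow> v \<kappa> = 0"
    and "chart_at B p \<kappa> \<Longrightarrow> chart_at B p \<mu> \<Longrightarrow>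
      v \<mu> = frechet_derivative (snd \<mu> \<circ> chart_inv \<kappa>) (at (snd \<kappa> p)) (v \<kappa>)"
  using assms unfolding tangent_space_def by blast+

text \<open>
  The tangent spaces are closed under the linear operations because the derivatives of coordinate
  changes, which relate the components of a tangent vector, are linear.
\<close>

lemma tangent_space_tadd:
  fixes B :: "('m, 'f::{real_normed_vector,heine_borel}) chart set"
  assumes "manifold B" "v \<in> tangent_space B p" "w \<in> tangent_space B p"
  shows "tadd v w \<in> tangent_space B p"
  unfolding tangent_space_def tadd_def
proof (intro CollectI conjI allI impI)
  fix \<kappa> \<mu> assume *: "chart_at B p \<kappa>" "chart_at B p \<mu>"
  show "v \<mu> + w \<mu> = frechet_derivative (snd \<mu> \<circ> chart_inv \<kappa>) (at (snd \<kappa> p)) (v \<kappa> + w \<kappa>)"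
    by (simp only: linear_add[OF chart_transition_linear[OF assms(1) *]]
        tangent_spaceD(2)[OF assms(2) *] tangent_spaceD(2)[OF assms(3) *])
qed (simp add: assms(2,3)[THEN tangent_spaceD(1)])

lemma tangent_space_tscale:
  fixes B :: "('m, 'f::{real_normed_vector,heine_borel}) chart set"
  assumes "manifold B" "v \<in> tangent_space B p"
  shows "tscale r v \<in> tangent_space B p"
  unfolding tangent_space_def tscale_def
proof (intro CollectI conjI allI impI)
  fix \<kappa> \<mu> assume *: "chart_at B p \<kappa>" "chart_at B p \<mu>"
  show "r *\<^sub>R v \<mu> = frechet_derivative (snd \<mu> \<circ> chart_inv \<kappa>) (at (snd \<kappa> p)) (r *\<^sub>R v \<kappa>)"
    by (simp only: linear_scale[OF chart_transition_linear[OF assms(1) *]] tangent_spaceD(2)[OF assms(2) *])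
qed (simp add: assms(2)[THEN tangent_spaceD(1)])

lemma tdiff_eq: "tdiff v w = tadd v (tscale (-1) w)"
  by (simp add: tdiff_def tadd_def tscale_def fun_eq_iff)

lemma tangent_space_tdiff:
  fixes B :: "('m, 'f::{real_normed_vector,heine_borel}) chart set"
  assumes "manifold B" "v \<in> tangent_space B p" "w \<in> tangent_space B p"
  shows "tdiff v w \<in> tangent_space B p"
  unfolding tdiff_eq by (intro tangent_space_tadd tangent_space_tscale assms)

text \<open>
  The part of a curve that runs in a chart is smooth on a relatively open subset of \<open>[0,1]\<close>, whereas
  velocities refer to \<open>[0,1]\<close>. The next two lemmas identify the two kinds of derivative and make
  them unique.
\<close>

lemma at_within_openin_Icc:
  fixes t :: real
  assumes "openin (top_of_set {0..1}) S" "t \<in> S"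
  shows "at t within S = at t within {0..1}"
proof -
  obtain T where "open T" "S = {0..1} \<inter> T"
    using assms(1) by (auto simp: openin_open)
  then show ?thesis
    using assms(2) by (intro at_within_nhd[of t T]) auto
qed

lemma islimpt_openin_Icc:
  fixes t :: real
  assumes "openin (top_of_set {0..1}) S" "t \<in> S"
  shows "t islimpt S"
proof -
  have "t \<in> {0..1}"
    using assms openin_imp_subset by blast
  then have "t islimpt {0..1}"
    by (simp add: islimpt_Icc)
  with at_within_openin_Icc[OF assms] show ?thesis
    by (metis trivial_limit_within)
qed

lemma curve_coord_has_velocity:
  assumes "c \<in> curves B" "t \<in> {0..1}" "chart_at B (c t) \<kappa>"
  shows "((snd \<kappa> \<circ> c) has_vector_derivative velocity B c t \<kappa>) (at t within {0..1})"
proof -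
  let ?S = "{t\<in>{0..1}. c t \<in> fst \<kappa>}"
  have S: "openin (top_of_set {0..1}) ?S" "smooth_on ?S (snd \<kappa> \<circ> c)" "t \<in> ?S"
    using assms by (auto simp: curves_def chart_at_def)
  have "((snd \<kappa> \<circ> c) has_vector_derivative vector_derivative (snd \<kappa> \<circ> c) (at t within ?S)) (at t within ?S)"
    using S by (intro smooth_on_has_vector_derivative islimpt_openin_Icc)
  then show ?thesis
    using assms(3) by (simp only: at_within_openin_Icc[OF S(1,3)] velocity_def if_True)
qed

lemma velocity_eqI:
  assumes "t \<in> {0..1}"
    and "\<And>\<kappa>. chart_at B (c t) \<kappa> \<Longrightarrow> ((snd \<kappa> \<circ> c) has_vector_derivative v \<kappa>) (at t within {0..1})"
    and "\<And>\<kappa>. \<not> chart_at B (c t) \<kappa> \<Longrightarrow> v \<kappa> = 0"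
  shows "velocity B c t = v"
proof
  fix \<kappa>
  have "at t within {0..1} \<noteq> bot"
    using assms(1) by (simp add: trivial_limit_within islimpt_Icc)
  then show "velocity B c t \<kappa> = v \<kappa>"
    using assms(2,3)[of \<kappa>] by (simp add: velocity_def vector_derivative_within)
qed

text \<open>
  This is the chain rule for \<open>snd \<mu> \<circ> c = (snd \<mu> \<circ> chart_inv \<kappa>) \<circ> (snd \<kappa> \<circ> c)\<close>. Directional
  derivatives of the coordinate change would not suffice, since \<open>snd \<kappa> \<circ> c\<close> moves along a curve.
\<close>

lemma velocity_in_tangent_space:
  fixes B :: "('m, 'f::{real_normed_vector,heine_borel}) chart set"
  assumes "manifold B" "c \<in> curves B" "t \<in> {0..1}"
  shows "velocity B c t \<in> tangent_space B (c t)"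
  unfolding tangent_space_def
proof (intro CollectI conjI allI impI)
  fix \<kappa> \<mu> assume \<kappa>: "chart_at B (c t) \<kappa>" and \<mu>: "chart_at B (c t) \<mu>"
  let ?S = "{t\<in>{0..1}. c t \<in> fst \<kappa>}" and ?T = "snd \<mu> \<circ> chart_inv \<kappa>"
  have S: "openin (top_of_set {0..1}) ?S" "t \<in> ?S"
    using assms \<kappa> by (auto simp: curves_def chart_at_def)
  note atS = at_within_openin_Icc[OF S]
  have "((snd \<kappa> \<circ> c) has_vector_derivative velocity B c t \<kappa>) (at t within ?S)"
    using curve_coord_has_velocity[OF assms(2,3) \<kappa>] by (simp only: atS)
  moreover have "(?T has_derivative frechet_derivative ?T (at (snd \<kappa> (c t))))
      (at ((snd \<kappa> \<circ> c) t) within (snd \<kappa> \<circ> c) ` ?S)"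
    using chart_transition_differentiable[OF assms(1) \<kappa> \<mu>]
    unfolding frechet_derivative_works o_apply[of "snd \<kappa>"] by (rule has_derivative_at_withinI)
  ultimately have "((?T \<circ> (snd \<kappa> \<circ> c)) has_vector_derivative
      frechet_derivative ?T (at (snd \<kappa> (c t))) (velocity B c t \<kappa>)) (at t within ?S)"
    by (rule vector_derivative_diff_chain_within)
  then have "((snd \<mu> \<circ> c) has_vector_derivative
      frechet_derivative ?T (at (snd \<kappa> (c t))) (velocity B c t \<kappa>)) (at t within ?S)"
    by (rule has_vector_derivative_transform[rotated -1])
      (use S(2) \<kappa> in \<open>auto simp: chart_inv_coord[OF assms(1)] chart_at_def\<close>)
  moreover have "((snd \<mu> \<circ> c) has_vector_derivative velocity B c t \<mu>) (at t within ?S)"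
    using curve_coord_has_velocity[OF assms(2,3) \<mu>] by (simp only: atS)
  moreover have "at t within ?S \<noteq> bot"
    using islimpt_openin_Icc[OF S] by (simp add: trivial_limit_within)
  ultimately show "velocity B c t \<mu> =
      frechet_derivative ?T (at (snd \<kappa> (c t))) (velocity B c t \<kappa>)"
    using vector_derivative_unique_within by blast
qed (simp add: velocity_def)

lemma manifold_set_tangent_bundle:
  "manifold_set (tangent_bundle B) = {(p, v). p \<in> manifold_set B \<and> v \<in> tangent_space B p}"
proof -
  have "tangent_bundle B =
      (\<lambda>\<kappa>. ({(p, v). p \<in> fst \<kappa> \<and> v \<in> tangent_space B p}, \<lambda>(p, v). (snd \<kappa> p, v \<kappa>))) ` B"
    unfolding tangent_bundle_def by (rule Setcompr_eq_image)
  then show ?thesis by (auto simp: manifold_set_def)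
qed

text \<open>
  In the bundle chart over \<open>\<kappa>\<close> the curve \<open>D c\<close> is \<open>snd \<kappa> \<circ> c\<close> paired with its derivative, which
  is smooth again. That \<open>D c\<close> stays in the domain of the bundle chart is the tangency above.
\<close>

lemma curve_D_in_curves:
  fixes B :: "('m, 'f::{real_normed_vector,heine_borel}) chart set"
  assumes "manifold B" "c \<in> curves B"
  shows "curve_D B c \<in> curves (tangent_bundle B)"
proof -
  have "curve_D B c t \<in> manifold_set (tangent_bundle B)" if "t \<in> {0..1}" for t
    using velocity_in_tangent_space[OF assms that] that assms(2)
    by (auto simp: manifold_set_tangent_bundle curve_D_def curves_def)
  then have "curve_D B c \<in> {0..1} \<rightarrow>\<^sub>E manifold_set (tangent_bundle B)"
    by (auto simp: curve_D_def)
  moreover have "openin (top_of_set {0..1}) {t\<in>{0..1}. curve_D B c t \<in> fst \<kappa>'} \<and>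
      smooth_on {t\<in>{0..1}. curve_D B c t \<in> fst \<kappa>'} (snd \<kappa>' \<circ> curve_D B c)"
    if \<kappa>': "\<kappa>' \<in> tangent_bundle B" for \<kappa>'
  proof -
    obtain \<kappa> where \<kappa>: "\<kappa> \<in> B" and \<kappa>'_eq: "\<kappa>' = ({(p, v). p \<in> fst \<kappa> \<and> v \<in> tangent_space B p},
        \<lambda>(p, v). (snd \<kappa> p, v \<kappa>))"
      using \<kappa>' by (auto simp: tangent_bundle_def)
    let ?S = "{t\<in>{0..1}. c t \<in> fst \<kappa>}"
    have S: "openin (top_of_set {0..1}) ?S" "smooth_on ?S (snd \<kappa> \<circ> c)"
      using assms \<kappa> by (auto simp: curves_def)
    have dom: "{t\<in>{0..1}. curve_D B c t \<in> fst \<kappa>'} = ?S"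
      using velocity_in_tangent_space[OF assms] by (auto simp: \<kappa>'_eq curve_D_def)
    have "smooth_on ?S (\<lambda>t. ((snd \<kappa> \<circ> c) t, vector_derivative (snd \<kappa> \<circ> c) (at t within ?S)))"
      by (intro smooth_on_Pair_real smooth_on_vector_derivative S islimpt_openin_Icc[OF S(1)])
    then have "smooth_on ?S (snd \<kappa>' \<circ> curve_D B c)"
    proof (rule smooth_on_cong)
      fix t assume t: "t \<in> ?S"
      then show "((snd \<kappa> \<circ> c) t, vector_derivative (snd \<kappa> \<circ> c) (at t within ?S)) =
          (snd \<kappa>' \<circ> curve_D B c) t"
        using \<kappa> unfolding at_within_openin_Icc[OF S(1) t]
        by (simp add: \<kappa>'_eq curve_D_def velocity_def chart_at_def)
    qed
    with S(1) dom show ?thesis by simp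
  qed
  ultimately show ?thesis by (simp add: curves_def)
qed

section \<open>Reparametrisation\<close>

lemma diff_plusD:
  assumes "\<phi> \<in> diff_plus"
  shows "bij_betw \<phi> {0..1} {0..1}" "smooth_on {0..1} \<phi>"
    and "\<And>t. t \<in> {0..1} \<Longrightarrow> \<phi> t \<in> {0..1}"
    and "\<And>t. t \<in> {0..1} \<Longrightarrow> vector_derivative \<phi> (at t within {0..1}) > 0"
    and "\<And>t. t \<in> {0..1} \<Longrightarrow>
      (\<phi> has_vector_derivative vector_derivative \<phi> (at t within {0..1})) (at t within {0..1})"
    and "continuous_on {0..1} \<phi>"
    and "smooth_on {0..1} (\<lambda>t. vector_derivative \<phi> (at t within {0..1}))"
proof -
  show *: "bij_betw \<phi> {0..1} {0..1}" "smooth_on {0..1} \<phi>"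
    using assms by (auto simp: diff_plus_def)
  show "\<phi> t \<in> {0..1}" if "t \<in> {0..1}" for t
    using * that by (auto simp: bij_betw_def)
  show "vector_derivative \<phi> (at t within {0..1}) > 0" if "t \<in> {0..1}" for t
    using assms that by (auto simp: diff_plus_def)
  show der: "(\<phi> has_vector_derivative vector_derivative \<phi> (at t within {0..1})) (at t within {0..1})"
    if "t \<in> {0..1}" for t
    using * that by (intro smooth_on_has_vector_derivative) (auto simp: islimpt_Icc)
  show "continuous_on {0..1} \<phi>"
    using der has_vector_derivative_continuous continuous_on_eq_continuous_within by blast
  show "smooth_on {0..1} (\<lambda>t. vector_derivative \<phi> (at t within {0..1}))"
    using * by (intro smooth_on_vector_derivative) (auto simp: islimpt_Icc)
qed

lemma compose_in_curves:
  assumes c: "c \<in> curves B" and \<phi>: "\<phi> \<in> diff_plus"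
  shows "compose {0..1} c \<phi> \<in> curves B"
proof -
  note \<phi> = diff_plusD[OF \<phi>]
  have "compose {0..1} c \<phi> \<in> {0..1} \<rightarrow>\<^sub>E manifold_set B"
    using c \<phi>(3) by (auto simp: curves_def compose_def PiE_def Pi_def)
  moreover have "openin (top_of_set {0..1}) {t\<in>{0..1}. compose {0..1} c \<phi> t \<in> fst \<kappa>} \<and>
      smooth_on {t\<in>{0..1}. compose {0..1} c \<phi> t \<in> fst \<kappa>} (snd \<kappa> \<circ> compose {0..1} c \<phi>)"
    if \<kappa>: "\<kappa> \<in> B" for \<kappa>
  proof -
    let ?S = "{t\<in>{0..1}. c t \<in> fst \<kappa>}" and ?T = "{t\<in>{0..1}. compose {0..1} c \<phi> t \<in> fst \<kappa>}"
    have S: "openin (top_of_set {0..1}) ?S" "smooth_on ?S (snd \<kappa> \<circ> c)"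
      using c \<kappa> by (auto simp: curves_def)
    have T_eq: "?T = {0..1} \<inter> \<phi> -` ?S"
    proof (rule Set.set_eqI)
      show "t \<in> ?T \<longleftrightarrow> t \<in> {0..1} \<inter> \<phi> -` ?S" for t
        by (cases "t \<in> {0..1}") (simp_all add: compose_def \<phi>(3) del: atLeastAtMost_iff)
    qed
    have T: "openin (top_of_set {0..1}) ?T"
      unfolding T_eq using S(1) \<phi>(3,6) by (intro continuous_openin_preimage[where T = "{0..1}"]) auto
    have "?T \<subseteq> {0..1}" "\<phi> ` ?T \<subseteq> ?S"
      using T_eq by blast+
    then have "smooth_on ?T ((snd \<kappa> \<circ> c) \<circ> \<phi>)"
      by (intro smooth_on_compose_real[OF S(2) smooth_on_subset[OF \<phi>(2)]] islimpt_openin_Icc[OF T])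
    then have "smooth_on ?T (snd \<kappa> \<circ> compose {0..1} c \<phi>)"
      by (rule smooth_on_cong) (simp add: compose_def)
    with T show ?thesis by simp
  qed
  ultimately show ?thesis by (simp add: curves_def)
qed

lemma velocity_compose:
  assumes c: "c \<in> curves B" and \<phi>: "\<phi> \<in> diff_plus" and t: "t \<in> {0..1}"
  shows "velocity B (compose {0..1} c \<phi>) t =
    tscale (vector_derivative \<phi> (at t within {0..1})) (velocity B c (\<phi> t))"
proof (rule velocity_eqI[OF t])
  note \<phi> = diff_plusD[OF \<phi>]
  have eq: "compose {0..1} c \<phi> s = c (\<phi> s)" if "s \<in> {0..1}" for s
    using that by (simp add: compose_def)
  fix \<kappa>
  show "((snd \<kappa> \<circ> compose {0..1} c \<phi>) has_vector_derivative
      tscale (vector_derivative \<phi> (at t within {0..1})) (velocity B c (\<phi> t)) \<kappa>) (at t within {0..1})"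
    if "chart_at B (compose {0..1} c \<phi> t) \<kappa>"
  proof (rule has_vector_derivative_transform[OF t])
    show "(((snd \<kappa> \<circ> c) \<circ> \<phi>) has_vector_derivative
      tscale (vector_derivative \<phi> (at t within {0..1})) (velocity B c (\<phi> t)) \<kappa>) (at t within {0..1})"
      unfolding tscale_def
    proof (rule vector_diff_chain_within[OF \<phi>(5)[OF t]])
      show "((snd \<kappa> \<circ> c) has_vector_derivative velocity B c (\<phi> t) \<kappa>) (at (\<phi> t) within \<phi> ` {0..1})"
        using curve_coord_has_velocity[OF c \<phi>(3)[OF t]] that \<phi>(1) eq[OF t]
        by (simp add: bij_betw_def)
    qed
  qed (simp add: eq)
  show "tscale (vector_derivative \<phi> (at t within {0..1})) (velocity B c (\<phi> t)) \<kappa> = 0"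
    if "\<not> chart_at B (compose {0..1} c \<phi> t) \<kappa>"
    using that by (simp add: tscale_def velocity_def eq[OF t])
qed

lemma curve_D_compose:
  assumes "c \<in> curves B" "\<phi> \<in> diff_plus" "t \<in> {0..1}"
  shows "curve_D B (compose {0..1} c \<phi>) t =
    (c (\<phi> t), tscale (vector_derivative \<phi> (at t within {0..1})) (velocity B c (\<phi> t)))"
  using assms(3) velocity_compose[OF assms] by (simp add: curve_D_def compose_eq)

text \<open>
  The substitution rule for absolutely integrable functions states absolute integrability on one
  side from that on the other. For nonnegative \<open>F\<close> it thus covers every function: if one side is not
  integrable then neither is the other, and both integrals have the default value \<open>0\<close>.
\<close>

lemma integral_reparametrise:
  fixes F :: "real \<Rightarrow> real"
  assumes \<phi>: "\<phi> \<in> diff_plus" and nonneg: "\<And>t. t \<in> {0..1} \<Longrightarrow> F t \<ge> 0"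
  shows "integral {0..1} (\<lambda>t. vector_derivative \<phi> (at t within {0..1}) * F (\<phi> t)) = integral {0..1} F"
proof -
  note \<phi> = diff_plusD[OF \<phi>]
  let ?\<phi>' = "\<lambda>t. vector_derivative \<phi> (at t within {0..1})"
  let ?L = "\<lambda>t. \<bar>?\<phi>' t\<bar> * F (\<phi> t)"
  have image: "\<phi> ` {0..1} = {0..1}"
    using \<phi>(1) by (simp add: bij_betw_def)
  have *: "?L absolutely_integrable_on {0..1} \<and> integral {0..1} ?L = b \<longleftrightarrow>
      F absolutely_integrable_on {0..1} \<and> integral {0..1} F = b" for b
    using has_absolute_integral_change_of_variables_1'[of "{0..1}" \<phi> ?\<phi>' F b] \<phi>(1,5)
    by (simp add: image bij_betw_def has_real_derivative_iff_has_vector_derivative)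
  have "integral {0..1} ?L = integral {0..1} F"
  proof (cases "F integrable_on {0..1}")
    case True
    then have "F absolutely_integrable_on {0..1}"
      using nonneg by (rule nonnegative_absolutely_integrable_1)
    with * show ?thesis by blast
  next
    case False
    then have "\<not> F absolutely_integrable_on {0..1}"
      using set_lebesgue_integral_eq_integral(1) by blast
    with * have "\<not> ?L absolutely_integrable_on {0..1}" by blast
    then have "\<not> ?L integrable_on {0..1}"
      using nonnegative_absolutely_integrable_1[of ?L "{0..1}"] nonneg \<phi>(3) by auto
    with False show ?thesis by (simp add: not_integrable_integral)
  qed
  also have "integral {0..1} ?L = integral {0..1} (\<lambda>t. ?\<phi>' t * F (\<phi> t))"
    using \<phi>(4) by (intro integral_cong) (simp add: abs_of_pos)
  finally show ?thesis .
qed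

section \<open>The square root velocity transform\<close>

lemma lie_norm_tscale:
  assumes "inner_product_on V (m \<one>\<^bsub>G\<^esub>)" "v \<in> V" "tscale r v \<in> V"
  shows "lie_norm G m (tscale r v) = \<bar>r\<bar> * lie_norm G m v"
proof -
  have scale: "m \<one>\<^bsub>G\<^esub> (tscale r v) u = r * m \<one>\<^bsub>G\<^esub> v u" if "u \<in> V" for u
    using assms that unfolding inner_product_on_def by blast
  have "m \<one>\<^bsub>G\<^esub> v (tscale r v) = m \<one>\<^bsub>G\<^esub> (tscale r v) v"
    using assms unfolding inner_product_on_def by blast
  then have "m \<one>\<^bsub>G\<^esub> (tscale r v) (tscale r v) = r\<^sup>2 * m \<one>\<^bsub>G\<^esub> v v"
    by (simp add: scale assms(2,3) power2_eq_square)
  then show ?thesis by (simp add: lie_norm_def real_sqrt_mult)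
qed

lemma tscale_tscale: "tscale r (tscale s v) = tscale (r * s) v"
  by (simp add: tscale_def)

lemma tdiff_tscale: "tdiff (tscale r v) (tscale r w) = tscale r (tdiff v w)"
  by (simp add: tdiff_def tscale_def scaleR_diff_right)

text \<open>
  The factor \<open>r\<close> becomes \<open>r / sqrt r = sqrt r\<close>. Where the norm of
  \<open>\<alpha> (D c)\<close> is \<open>0\<close>, both sides are zero by the convention \<open>1 / 0 = 0\<close>.
\<close>

lemma srvt_reparametrise:
  assumes ip: "inner_product_on V (m \<one>\<^bsub>G\<^esub>)" and scale: "\<And>r v. v \<in> V \<Longrightarrow> tscale r v \<in> V"
    and t: "t \<in> {0..1}" "s \<in> {0..1}" and r: "r > 0"
    and V: "\<alpha> (curve_D B c) s \<in> V"
    and c': "\<alpha> (curve_D B c') t = tscale r (\<alpha> (curve_D B c) s)"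
  shows "srvt G m B \<alpha> c' t = tscale (sqrt r) (srvt G m B \<alpha> c s)"
proof -
  let ?a = "\<alpha> (curve_D B c) s"
  have "srvt G m B \<alpha> c' t = tscale (1 / sqrt (r * lie_norm G m ?a) * r) ?a"
    using t r lie_norm_tscale[where m = m and G = G, OF ip V scale[OF V]]
    by (simp add: srvt_def c' tscale_tscale)
  also have "1 / sqrt (r * lie_norm G m ?a) * r = sqrt r * (1 / sqrt (lie_norm G m ?a))"
  proof -
    have "r / sqrt r = sqrt r" using r by (simp add: real_div_sqrt)
    then show ?thesis by (simp add: real_sqrt_mult flip: divide_divide_eq_left)
  qed
  finally show ?thesis
    using t by (simp add: srvt_def tscale_tscale)
qed

text \<open>
  The squared factor \<open>(sqrt \<phi>')\<^sup>2 = \<phi>'\<close> is the density that the substitution by \<open>\<phi>\<close> calls for. The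
  subspace \<open>V\<close> stands for the Lie algebra, outside of which the norm need not be homogeneous.
\<close>

lemma srvt_dist_reparametrise:
  assumes ip: "inner_product_on V (m \<one>\<^bsub>G\<^esub>)"
    and scale: "\<And>r v. v \<in> V \<Longrightarrow> tscale r v \<in> V"
    and diff: "\<And>v w. v \<in> V \<Longrightarrow> w \<in> V \<Longrightarrow> tdiff v w \<in> V"
    and \<phi>: "\<phi> \<in> diff_plus"
    and V: "\<And>c t. c \<in> {f, g} \<Longrightarrow> t \<in> {0..1} \<Longrightarrow> \<alpha> (curve_D B c) t \<in> V"
    and chain: "\<And>c t. c \<in> {f, g} \<Longrightarrow> t \<in> {0..1} \<Longrightarrow> \<alpha> (curve_D B (compose {0..1} c \<phi>)) t =
      tscale (vector_derivative \<phi> (at t within {0..1})) (\<alpha> (curve_D B c) (\<phi> t))"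
  shows "srvt_dist G m B \<alpha> (compose {0..1} f \<phi>) (compose {0..1} g \<phi>) = srvt_dist G m B \<alpha> f g"
proof -
  let ?\<phi>' = "\<lambda>t. vector_derivative \<phi> (at t within {0..1})"
  define F where "F t = (lie_norm G m (tdiff (srvt G m B \<alpha> f t) (srvt G m B \<alpha> g t)))\<^sup>2" for t
  have R: "srvt G m B \<alpha> c t \<in> V" if "c \<in> {f, g}" "t \<in> {0..1}" for c t
    using scale[OF V[OF that]] that(2) by (simp add: srvt_def)
  have "(lie_norm G m (tdiff (srvt G m B \<alpha> (compose {0..1} f \<phi>) t) (srvt G m B \<alpha> (compose {0..1} g \<phi>) t)))\<^sup>2
      = ?\<phi>' t * F (\<phi> t)" if t: "t \<in> {0..1}" for t
  proof -
    have \<phi>t: "\<phi> t \<in> {0..1}" and pos: "?\<phi>' t > 0"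
      using diff_plusD(3,4)[OF \<phi> t] .
    have eq: "srvt G m B \<alpha> (compose {0..1} c \<phi>) t = tscale (sqrt (?\<phi>' t)) (srvt G m B \<alpha> c (\<phi> t))"
      if "c \<in> {f, g}" for c
      using ip scale t \<phi>t pos V[OF that \<phi>t] chain[OF that t] by (rule srvt_reparametrise)
    have D: "tdiff (srvt G m B \<alpha> f (\<phi> t)) (srvt G m B \<alpha> g (\<phi> t)) \<in> V"
      using R \<phi>t by (intro diff) auto
    show ?thesis
      using pos lie_norm_tscale[where m = m and G = G, OF ip D scale[OF D]]
      by (simp add: eq tdiff_tscale F_def power_mult_distrib)
  qed
  then have "integral {0..1} (\<lambda>t. (lie_norm G m (tdiff (srvt G m B \<alpha> (compose {0..1} f \<phi>) t)
      (srvt G m B \<alpha> (compose {0..1} g \<phi>) t)))\<^sup>2) = integral {0..1} (\<lambda>t. ?\<phi>' t * F (\<phi> t))"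
    by (intro integral_cong)
  also have "\<dots> = integral {0..1} F"
    by (rule integral_reparametrise[OF \<phi>]) (simp add: F_def)
  finally show ?thesis by (simp only: srvt_dist_def F_def[abs_def])
qed

text \<open>
  Linearity over the smooth functions on \<open>[0,1]\<close> is essential here: the factor \<open>\<phi>'\<close> depends on time.
  It is applied to the reparametrised curve \<open>D c \<circ> \<phi>\<close> rather than to \<open>D c\<close>, after which
  equivariance moves \<open>\<phi>\<close> out of \<open>\<alpha>\<close>.
\<close>

lemma fibre_linear_chain:
  fixes B :: "('m, 'f::{real_normed_vector,heine_borel}) chart set"
  assumes "manifold B" "fibre_linear B \<alpha>" "reparam_equivariant B \<alpha>"
    and c: "c \<in> curves B" and \<phi>: "\<phi> \<in> diff_plus" and t: "t \<in> {0..1}"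
  shows "\<alpha> (curve_D B (compose {0..1} c \<phi>)) t =
    tscale (vector_derivative \<phi> (at t within {0..1})) (\<alpha> (curve_D B c) (\<phi> t))"
proof -
  let ?\<phi>' = "\<lambda>t. vector_derivative \<phi> (at t within {0..1})"
  let ?v = "compose {0..1} (curve_D B c) \<phi>"
  have Dc: "curve_D B c \<in> curves (tangent_bundle B)"
    by (rule curve_D_in_curves) fact+
  have v: "?v \<in> curves (tangent_bundle B)"
    by (rule compose_in_curves[OF Dc \<phi>])
  have "curve_D B (compose {0..1} c \<phi>) = (\<lambda>t\<in>{0..1}. (fst (?v t), tscale (?\<phi>' t) (snd (?v t))))"
  proof
    fix s
    show "curve_D B (compose {0..1} c \<phi>) s = (\<lambda>t\<in>{0..1}. (fst (?v t), tscale (?\<phi>' t) (snd (?v t)))) s"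
    proof (cases "s \<in> {0..1}")
      case True
      with curve_D_compose[OF c \<phi> True] diff_plusD(3)[OF \<phi> True] show ?thesis
        by (simp add: compose_eq curve_D_def)
    next
      case False
      then show ?thesis by (simp only: curve_D_def restrict_apply if_False)
    qed
  qed
  moreover have "\<alpha> (\<lambda>t\<in>{0..1}. (fst (?v t), tscale (?\<phi>' t) (snd (?v t)))) = (\<lambda>t\<in>{0..1}. tscale (?\<phi>' t) (\<alpha> ?v t))"
    using assms(2)[unfolded fibre_linear_def, THEN conjunct2, rule_format, OF v diff_plusD(7)[OF \<phi>]] .
  ultimately have "\<alpha> (curve_D B (compose {0..1} c \<phi>)) = (\<lambda>t\<in>{0..1}. tscale (?\<phi>' t) (\<alpha> ?v t))"
    by (simp only:)
  moreover have "\<alpha> ?v = compose {0..1} (\<alpha> (curve_D B c)) \<phi>"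
    using assms(3) Dc \<phi> by (simp add: reparam_equivariant_def)
  ultimately show ?thesis using t by (simp add: compose_eq)
qed

text \<open>
  A superposition operator acts at each time separately, so homogeneity of \<open>\<omega>\<close> on the single tangent
  space at \<open>c (\<phi> t)\<close> is enough.
\<close>

lemma theta_chain:
  fixes B :: "('m, 'f::{real_normed_vector,heine_borel}) chart set"
  assumes "manifold B" "one_form B G A \<omega>"
    and \<alpha>: "\<forall>v\<in>curves (tangent_bundle B). \<alpha> v = theta \<omega> v"
    and c: "c \<in> curves B" and \<phi>: "\<phi> \<in> diff_plus" and t: "t \<in> {0..1}"
  shows "\<alpha> (curve_D B (compose {0..1} c \<phi>)) t =
    tscale (vector_derivative \<phi> (at t within {0..1})) (\<alpha> (curve_D B c) (\<phi> t))"
proof -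
  let ?\<phi>' = "vector_derivative \<phi> (at t within {0..1})"
  have \<phi>t: "\<phi> t \<in> {0..1}" by (rule diff_plusD(3)[OF \<phi> t])
  have *: "\<alpha> (curve_D B c') s = \<omega> (curve_D B c' s)" if "c' \<in> curves B" "s \<in> {0..1}" for c' s
    using \<alpha> curve_D_in_curves[OF assms(1) that(1)] that(2) by (simp add: theta_def compose_eq)
  have "c (\<phi> t) \<in> manifold_set B"
    using c \<phi>t by (auto simp: curves_def)
  moreover have "velocity B c (\<phi> t) \<in> tangent_space B (c (\<phi> t))"
    by (rule velocity_in_tangent_space) fact+
  ultimately have "\<omega> (c (\<phi> t), tscale ?\<phi>' (velocity B c (\<phi> t))) =
      tscale ?\<phi>' (\<omega> (c (\<phi> t), velocity B c (\<phi> t)))"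
    using assms(2) by (auto simp: one_form_def)
  then show ?thesis
    using *[OF compose_in_curves[OF c \<phi>] t] *[OF c \<phi>t] curve_D_compose[OF c \<phi> t] \<phi>t
    by (simp add: curve_D_def)
qed

theorem lemma13:
  fixes G :: "('g, 'z) monoid_scheme"
    and A :: "('g, 'e::{real_normed_vector,heine_borel}) chart set"
    and H :: "'g set"
    and B :: "('g set, 'f::{real_normed_vector,heine_borel}) chart set"
    and m :: "'g \<Rightarrow> ('g, 'e) tangent \<Rightarrow> ('g, 'e) tangent \<Rightarrow> real"
    and c\<^sub>0 :: "'g set"
    and \<alpha> :: "(real \<Rightarrow> 'g set \<times> ('g set, 'f) tangent) \<Rightarrow> (real \<Rightarrow> ('g, 'e) tangent)"
  assumes "homogeneous_space G A H B"
    and "riemannian_metric A m" and "right_invariant G A m"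
    and "c\<^sub>0 \<in> manifold_set B"
    and "smooth_curve_map (tangent_bundle B) G A \<alpha>"
    and "\<forall>c\<in>curves_from B c\<^sub>0. rho G A c\<^sub>0 (\<alpha> (curve_D B c)) = c"
    and "\<forall>c\<in>immersed_curves_from B c\<^sub>0. \<forall>t\<in>{0..1}. \<alpha> (curve_D B c) t \<noteq> tzero"
  shows "(curve_one_form B G A \<alpha> \<and> reparam_equivariant B \<alpha> \<longrightarrow>
            reparam_invariant (immersed_curves_from B c\<^sub>0) (srvt_dist G m B \<alpha>)) \<and>
         (\<forall>\<omega>. one_form B G A \<omega> \<and> (\<forall>v\<in>curves (tangent_bundle B). \<alpha> v = theta \<omega> v) \<longrightarrow>
            reparam_invariant (immersed_curves_from B c\<^sub>0) (srvt_dist G m B \<alpha>))"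
proof -
  let ?V = "tangent_space A \<one>\<^bsub>G\<^esub>"
  have B: "manifold B" and A: "manifold A" and G: "group G" "manifold_set A = carrier G"
    using assms(1) by (auto simp: homogeneous_space_def lie_group_def)
  have ip: "inner_product_on ?V (m \<one>\<^bsub>G\<^esub>)"
    using assms(2) group.is_monoid[OF G(1)] monoid.one_closed[of G] G(2)
    by (auto simp: riemannian_metric_def)
  have V: "\<alpha> (curve_D B c) t \<in> ?V" if "c \<in> curves B" "t \<in> {0..1}" for c t
  proof -
    have "\<alpha> (curve_D B c) \<in> lie_curves G A"
      using assms(5) curve_D_in_curves[OF B that(1)] unfolding smooth_curve_map_def by blast
    then show ?thesis
      using that(2) by (auto simp: lie_curves_def lie_algebra_def)
  qed
  have invariant: "reparam_invariant (immersed_curves_from B c\<^sub>0) (srvt_dist G m B \<alpha>)"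
    if chain: "\<And>c \<phi> t. c \<in> curves B \<Longrightarrow> \<phi> \<in> diff_plus \<Longrightarrow> t \<in> {0..1} \<Longrightarrow>
      \<alpha> (curve_D B (compose {0..1} c \<phi>)) t =
        tscale (vector_derivative \<phi> (at t within {0..1})) (\<alpha> (curve_D B c) (\<phi> t))"
    unfolding reparam_invariant_def
  proof (intro ballI)
    fix f g \<phi>
    assume "f \<in> immersed_curves_from B c\<^sub>0" "g \<in> immersed_curves_from B c\<^sub>0" and \<phi>: "\<phi> \<in> diff_plus"
    then have fg: "c \<in> curves B" if "c \<in> {f, g}" for c
      using that by (auto simp: immersed_curves_from_def curves_from_def)
    show "srvt_dist G m B \<alpha> f g = srvt_dist G m B \<alpha> (compose {0..1} f \<phi>) (compose {0..1} g \<phi>)"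
      by (rule srvt_dist_reparametrise[where m = m and G = G, symmetric, OF ip])
        (use \<phi> V[OF fg] chain[OF fg \<phi>] in \<open>simp_all add: tangent_space_tscale[OF A] tangent_space_tdiff[OF A]\<close>)
  qed
  show ?thesis
  proof (intro conjI impI allI; elim conjE)
    assume "curve_one_form B G A \<alpha>" "reparam_equivariant B \<alpha>"
    then show "reparam_invariant (immersed_curves_from B c\<^sub>0) (srvt_dist G m B \<alpha>)"
      by (intro invariant fibre_linear_chain[OF B]) (auto simp: curve_one_form_def)
  next
    fix \<omega> assume "one_form B G A \<omega>" "\<forall>v\<in>curves (tangent_bundle B). \<alpha> v = theta \<omega> v"
    then show "reparam_invariant (immersed_curves_from B c\<^sub>0) (srvt_dist G m B \<alpha>)"
      by (rule invariant[OF theta_chain[OF B]])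
  qed
qed

end
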